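(* Consider the problem $\phi_*=\min\{\phi(z):=g(z)+h(z):z\in\mathbb{R}^n\}$ under assumptions (A1)–(A3) of the context. Let $z_0\in\operatorname{dom}h$, $\sigma\in(0,1)$, $0<\lambda\le1/(2m)$ and $\bar\rho,\bar\varepsilon>0$. Then the AIPP method (described in the context) with these inputs terminates with a quintuple $(\lambda,z^-,z,w,\varepsilon)$ which is a $(\bar\rho,\bar\varepsilon)$-prox-approximate solution, i.e., $$w\in\partial_\varepsilon\left(\phi+\frac1{2\lambda}\|\cdot-z^-\|^2\right)(z),\qquad\left\|\frac1\lambda(z^--z)+w\right\|\le\bar\rho,\qquad\varepsilon\le\bar\varepsilon,$$ within $$\mathcal{O}\left\{\sqrt{\lambda M+1}\left[\frac{R(\phi;\lambda)}{\lambda^2\bar\rho^2}+\log_1^+\left(\frac{\bar\rho\sqrt{(\lambda M+1)\lambda}}{\sqrt{\bar\varepsilon}}\right)\right]\right\}$$ inner (ACG) iterations, where the constant hidden in $\mathcal{O}(\cdot)$ depends only on $\sigma$ and $$R(\phi;\lambda):=\inf\left\{\tfrac12\|z_0-u\|^2+(1-\sigma)\lambda[\phi(u)-\phi_*]:u\in\mathbb{R}^n\right\}.$$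
   Context: Notation: $\log_1^+(t):=\max\{\log t,1\}$ for $t>0$; $\ell_\psi(u;z):=\psi(z)+\langle\nabla\psi(z),u-z\rangle$. For $\psi:\mathbb{R}^n\to(-\infty,\infty]$, $\varepsilon\ge0$, $z\in\operatorname{dom}\psi$, $\partial_\varepsilon\psi(z):=\{v:\psi(u)\ge\psi(z)+\langle v,u-z\rangle-\varepsilon\ \forall u\in\mathbb{R}^n\}$ (no convexity of $\psi$ required). The function $\phi=g+h$ is $+\infty$ outside $\operatorname{dom}h$. Assumptions: (A1) $h:\mathbb{R}^n\to(-\infty,\infty]$ is proper, lower semicontinuous and convex; (A2) $g$ is differentiable on $\operatorname{dom}h$ and, for some $M\ge m>0$, $-\frac m2\|u-z\|^2\le g(u)-\ell_g(u;z)\le\frac M2\|u-z\|^2$ for all $z,u\in\operatorname{dom}h$; (A3) $\phi_*:=\inf_{z}\phi(z)>-\infty$. ACG method. Applied to $\min_x\{\psi(x):=\psi_s(x)+\psi_n(x)\}$, where $\psi_n$ is proper closed $\mu$-strongly convex and $\psi_s$ is convex, differentiable on $\operatorname{dom}\psi_n$ with $\psi_s(u)-\ell_{\psi_s}(u;x)\le\frac L2\|u-x\|^2$ on $\operatorname{dom}\psi_n$, from a starting point $x_0\in\operatorname{dom}\psi_n$: set $y_0=x_0$, $A_0=0$, $\Gamma_0\equiv0$, and for $j=0,1,2,\dots$ compute $A_{j+1}=A_j+\frac{\mu A_j+1+\sqrt{(\mu A_j+1)^2+4L(\mu A_j+1)A_j}}{2L}$, $\tilde x_j=\frac{A_j}{A_{j+1}}x_j+\frac{A_{j+1}-A_j}{A_{j+1}}y_j$,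 $\Gamma_{j+1}=\frac{A_j}{A_{j+1}}\Gamma_j+\frac{A_{j+1}-A_j}{A_{j+1}}\ell_{\psi_s}(\cdot;\tilde x_j)$, $y_{j+1}=\operatorname{argmin}_y\{\Gamma_{j+1}(y)+\psi_n(y)+\frac{1}{2A_{j+1}}\|y-y_0\|^2\}$, $x_{j+1}=\frac{A_j}{A_{j+1}}x_j+\frac{A_{j+1}-A_j}{A_{j+1}}y_{j+1}$, $u_{j+1}=\frac{y_0-y_{j+1}}{A_{j+1}}$, $\eta_{j+1}=\psi(x_{j+1})-\Gamma_{j+1}(y_{j+1})-\psi_n(y_{j+1})-\langle u_{j+1},x_{j+1}-y_{j+1}\rangle$. Each such pass is one ACG (inner) iteration, producing the triple $(x_{j+1},u_{j+1},\eta_{j+1})$. AIPP method. Inputs: $z_0\in\operatorname{dom}h$, $\sigma\in(0,1)$, $(m,M)$ as in (A2), $0<\lambda\le1/(2m)$, tolerances $\bar\rho,\bar\varepsilon>0$. Set $k=1$. Step 1: run the ACG method from $x_0=z_{k-1}$ with $\psi_s=\lambda g+\frac14\|\cdot-z_{k-1}\|^2$, $\psi_n=\lambda h+\frac14\|\cdot-z_{k-1}\|^2$ (with $\mu=1/2$, $L=\lambda M+1/2$) for at least $\lceil6\sqrt{2\lambda M+1}\rceil$ iterations, and until a triple $(x,u,\eta)$ is obtained with $u\in\partial_\eta(\lambda(g+h)+\frac12\|\cdot-z_{k-1}\|^2)(x)$ and $\|u\|^2+2\eta\le\sigma\|z_{k-1}-x+u\|^2$ (the inclusion holds for every ACG iterate,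 so only the inequality is checked). Step 2: if $\|z_{k-1}-x+u\|\le\lambda\bar\rho/5$, go to Step 3; otherwise set $(z_k,\tilde v_k,\tilde\varepsilon_k)=(x,u,\eta)$, $k\leftarrow k+1$ and go to Step 1. Step 3: continue the last ACG run until an iterate $(\tilde x,\tilde u,\tilde\eta)$ is found satisfying the two conditions of Step 1 (with $(x,u,\eta)$ replaced by $(\tilde x,\tilde u,\tilde\eta)$) and $\tilde\eta/\lambda\le\bar\varepsilon$; set $(z_k,\tilde v_k,\tilde\varepsilon_k)=(\tilde x,\tilde u,\tilde\eta)$ and output $(\lambda,z^-,z,w,\varepsilon)=(\lambda,z_{k-1},z_k,\tilde v_k/\lambda,\tilde\varepsilon_k/\lambda)$. The number of inner iterations is the total number of ACG iterations performed in Steps 1 and 3. *)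

theory Defs
  imports "HOL-Analysis.Analysis"
begin

text \<open>
  The hidden constant of the complexity bound must not depend on the dimension, so \<open>n\<close> has to be
  quantified inside the statement, after the constant. A type-indexed dimension does not allow
  this. Hence all spaces \<open>\<real>\<^sup>n\<close> are taken inside one inner product space, the finitely supported
  real sequences with the Euclidean inner product: \<open>\<real>\<^sup>n\<close> is the subspace \<open>Rn n\<close> of the
  sequences that vanish from index \<open>n\<close> on.
\<close>

typedef fseq = "{f :: nat \<Rightarrow> real. finite {i. f i \<noteq> 0}}"
  morphisms coord Abs_fseq
  by (rule exI[of _ "\<lambda>_. 0"]) simp

setup_lifting type_definition_fseq

instantiation fseq :: real_vector
begin

lift_definition zero_fseq :: fseq is "\<lambda>_. 0" by simp

lift_definition plus_fseq :: "fseq \<Rightarrow> fseq \<Rightarrow> fseq" is "\<lambda>f g i. f i + g i"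
  subgoal for f g by (rule finite_subset[of _ "{i. f i \<noteq> 0} \<union> {i. g i \<noteq> 0}"]) auto
  done

lift_definition minus_fseq :: "fseq \<Rightarrow> fseq \<Rightarrow> fseq" is "\<lambda>f g i. f i - g i"
  subgoal for f g by (rule finite_subset[of _ "{i. f i \<noteq> 0} \<union> {i. g i \<noteq> 0}"]) auto
  done

lift_definition uminus_fseq :: "fseq \<Rightarrow> fseq" is "\<lambda>f i. - f i"
  by simp

lift_definition scaleR_fseq :: "real \<Rightarrow> fseq \<Rightarrow> fseq" is "\<lambda>r f i. r * f i"
  by (rule finite_subset[rotated]) auto

instance
  by standard (transfer; simp add: algebra_simps fun_eq_iff)+

end

instantiation fseq :: real_inner
begin

definition inner_fseq :: "fseq \<Rightarrow> fseq \<Rightarrow> real" where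
  "inner_fseq x y = (\<Sum>i | coord x i \<noteq> 0. coord x i * coord y i)"

definition norm_fseq :: "fseq \<Rightarrow> real" where
  "norm_fseq x = sqrt (inner x x)"

definition sgn_fseq :: "fseq \<Rightarrow> fseq" where
  "sgn_fseq x = x /\<^sub>R norm x"

definition dist_fseq :: "fseq \<Rightarrow> fseq \<Rightarrow> real" where
  "dist_fseq x y = norm (x - y)"

definition uniformity_fseq :: "(fseq \<times> fseq) filter" where
  "uniformity_fseq = (INF e\<in>{0<..}. principal {(x, y). dist x y < e})"

definition open_fseq :: "fseq set \<Rightarrow> bool" where
  "open_fseq U \<longleftrightarrow> (\<forall>x\<in>U. eventually (\<lambda>(x', y). x' = x \<longrightarrow> y \<in> U) uniformity)"

instance
proof
  have fin: "finite {i. coord x i \<noteq> 0}" for x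
    using coord[of x] by simp
  have inner_alt: "inner x y = (\<Sum>i\<in>S. coord x i * coord y i)"
    if "finite S" "{i. coord x i \<noteq> 0} \<subseteq> S" for x y S
    unfolding inner_fseq_def by (rule sum.mono_neutral_left) (use that in auto)
  fix x y z :: fseq and r :: real and U :: "fseq set"
  show "inner x y = inner y x"
    using inner_alt[of "{i. coord x i \<noteq> 0} \<union> {i. coord y i \<noteq> 0}" x y]
      inner_alt[of "{i. coord x i \<noteq> 0} \<union> {i. coord y i \<noteq> 0}" y x] fin
    by (simp add: mult.commute)
  show "inner (x + y) z = inner x z + inner y z"
  proof -
    let ?S = "{i. coord x i \<noteq> 0} \<union> {i. coord y i \<noteq> 0}"
    have "finite ?S" "{i. coord (x + y) i \<noteq> 0} \<subseteq> ?S"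
      using fin by (auto simp: plus_fseq.rep_eq)
    then show ?thesis
      using inner_alt[of ?S "x + y" z] inner_alt[of ?S x z] inner_alt[of ?S y z]
      by (simp add: plus_fseq.rep_eq algebra_simps sum.distrib)
  qed
  show "inner (r *\<^sub>R x) y = r * inner x y"
    using inner_alt[of "{i. coord x i \<noteq> 0}" "r *\<^sub>R x" y] inner_alt[of "{i. coord x i \<noteq> 0}" x y] fin
    by (auto simp: scaleR_fseq.rep_eq sum_distrib_left mult.assoc)
  show "0 \<le> inner x x"
    by (simp add: inner_fseq_def sum_nonneg)
  show "inner x x = 0 \<longleftrightarrow> x = 0"
    using fin[of x] by (auto simp: inner_fseq_def sum_nonneg_eq_0_iff zero_fseq.rep_eq
        coord_inject[symmetric] fun_eq_iff)
qed (auto simp: norm_fseq_def sgn_fseq_def dist_fseq_def uniformity_fseq_def open_fseq_def)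

end

definition Rn :: "nat \<Rightarrow> fseq set" where
  "Rn n = {x. \<forall>i\<ge>n. coord x i = 0}"

definition edom :: "nat \<Rightarrow> (fseq \<Rightarrow> ereal) \<Rightarrow> fseq set" where
  "edom n f = {x \<in> Rn n. f x < \<infinity>}"

definition proper :: "nat \<Rightarrow> (fseq \<Rightarrow> ereal) \<Rightarrow> bool" where
  "proper n f \<longleftrightarrow> (\<forall>x\<in>Rn n. f x \<noteq> -\<infinity>) \<and> edom n f \<noteq> {}"

definition lower_semicontinuous :: "nat \<Rightarrow> (fseq \<Rightarrow> ereal) \<Rightarrow> bool" where
  "lower_semicontinuous n f \<longleftrightarrow> (\<forall>z\<in>Rn n. f z \<le> Liminf (at z within Rn n) f)"

definition convex_ereal :: "nat \<Rightarrow> (fseq \<Rightarrow> ereal) \<Rightarrow> bool" where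
  "convex_ereal n f \<longleftrightarrow> (\<forall>x\<in>Rn n. \<forall>y\<in>Rn n. \<forall>t. 0 \<le> t \<and> t \<le> 1 \<longrightarrow>
     f ((1 - t) *\<^sub>R x + t *\<^sub>R y) \<le> ereal (1 - t) * f x + ereal t * f y)"

definition lin :: "(fseq \<Rightarrow> real) \<Rightarrow> (fseq \<Rightarrow> fseq) \<Rightarrow> fseq \<Rightarrow> fseq \<Rightarrow> real" where
  "lin f Df z u = f z + Df z \<bullet> (u - z)"

definition eps_subdiff :: "nat \<Rightarrow> real \<Rightarrow> (fseq \<Rightarrow> ereal) \<Rightarrow> fseq \<Rightarrow> fseq set" where
  "eps_subdiff n \<epsilon> \<psi> z = {v \<in> Rn n. \<forall>u\<in>Rn n. \<psi> u \<ge> \<psi> z + ereal (v \<bullet> (u - z) - \<epsilon>)}"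

definition assmA1 :: "nat \<Rightarrow> (fseq \<Rightarrow> ereal) \<Rightarrow> bool" where
  "assmA1 n h \<longleftrightarrow> proper n h \<and> lower_semicontinuous n h \<and> convex_ereal n h"

text \<open>
  \<open>Dg\<close> is the gradient of \<open>g\<close> on \<open>dom h\<close>. Differentiability is relative to \<open>dom h\<close>, as in
  \<^const>\<open>differentiable_on\<close>; a gradient in \<open>\<real>\<^sup>n\<close> (for \<open>g\<close> defined around \<open>dom h\<close>) is a special case.
  If \<open>dom h\<close> has empty interior, \<open>Dg\<close> may be any gradient field with the stated bounds.
\<close>

definition assmA2 :: "nat \<Rightarrow> (fseq \<Rightarrow> real) \<Rightarrow> (fseq \<Rightarrow> fseq) \<Rightarrow> (fseq \<Rightarrow> ereal) \<Rightarrow> real \<Rightarrow> real \<Rightarrow> bool"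
  where
  "assmA2 n g Dg h m M \<longleftrightarrow>
     0 < m \<and> m \<le> M \<and>
     (\<forall>z\<in>edom n h. Dg z \<in> Rn n \<and>
        (g has_derivative (\<lambda>v. Dg z \<bullet> v)) (at z within edom n h)) \<and>
     (\<forall>z\<in>edom n h. \<forall>u\<in>edom n h.
        - (m / 2) * (norm (u - z))\<^sup>2 \<le> g u - lin g Dg z u \<and>
        g u - lin g Dg z u \<le> M / 2 * (norm (u - z))\<^sup>2)"

definition phi :: "(fseq \<Rightarrow> real) \<Rightarrow> (fseq \<Rightarrow> ereal) \<Rightarrow> fseq \<Rightarrow> ereal" where
  "phi g h z = ereal (g z) + h z"

definition phi_star :: "nat \<Rightarrow> (fseq \<Rightarrow> real) \<Rightarrow> (fseq \<Rightarrow> ereal) \<Rightarrow> ereal" where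
  "phi_star n g h = (INF z\<in>Rn n. phi g h z)"

definition assmA3 :: "nat \<Rightarrow> (fseq \<Rightarrow> real) \<Rightarrow> (fseq \<Rightarrow> ereal) \<Rightarrow> bool" where
  "assmA3 n g h \<longleftrightarrow> phi_star n g h > -\<infinity>"

text \<open>
  The ACG state after \<open>j\<close> iterations is \<open>(A\<^sub>j, x\<^sub>j, y\<^sub>j, \<Gamma>\<^sub>j)\<close>; \<open>D\<psi>s\<close> is the gradient of \<open>\<psi>s\<close>.
  The minimizer defining \<open>y\<^sub>j\<^sub>+\<^sub>1\<close> exists and is unique when \<open>\<psi>n\<close> is proper, closed and
  \<open>\<mu>\<close>-strongly convex.
\<close>

primrec acg_state ::
  "nat \<Rightarrow> (fseq \<Rightarrow> real) \<Rightarrow> (fseq \<Rightarrow> fseq) \<Rightarrow> (fseq \<Rightarrow> ereal) \<Rightarrow> real \<Rightarrow> real \<Rightarrow> fseq \<Rightarrow> nat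
     \<Rightarrow> real \<times> fseq \<times> fseq \<times> (fseq \<Rightarrow> real)" where
  "acg_state n \<psi>s D\<psi>s \<psi>n \<mu> L x0 0 = (0, x0, x0, \<lambda>_. 0)"
| "acg_state n \<psi>s D\<psi>s \<psi>n \<mu> L x0 (Suc j) =
    (let (A, x, y, \<Gamma>) = acg_state n \<psi>s D\<psi>s \<psi>n \<mu> L x0 j;
         A' = A + (\<mu> * A + 1 + sqrt ((\<mu> * A + 1)\<^sup>2 + 4 * L * (\<mu> * A + 1) * A)) / (2 * L);
         xt = (A / A') *\<^sub>R x + ((A' - A) / A') *\<^sub>R y;
         \<Gamma>' = (\<lambda>w. A / A' * \<Gamma> w + (A' - A) / A' * lin \<psi>s D\<psi>s xt w);
         y' = arg_min_on (\<lambda>w. ereal (\<Gamma>' w) + \<psi>n w + ereal (1 / (2 * A') * (norm (w - x0))\<^sup>2)) (Rn n);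
         x' = (A / A') *\<^sub>R x + ((A' - A) / A') *\<^sub>R y'
     in (A', x', y', \<Gamma>'))"

text \<open>
  The triple \<open>(x\<^sub>j, u\<^sub>j, \<eta>\<^sub>j)\<close>, meaningful for \<open>j \<ge> 1\<close> only. All values of \<open>\<psi>n\<close> taken here are
  finite, since \<open>x\<^sub>j\<close> and \<open>y\<^sub>j\<close> lie in its domain.
\<close>

definition acg_triple ::
  "nat \<Rightarrow> (fseq \<Rightarrow> real) \<Rightarrow> (fseq \<Rightarrow> fseq) \<Rightarrow> (fseq \<Rightarrow> ereal) \<Rightarrow> real \<Rightarrow> real \<Rightarrow> fseq \<Rightarrow> nat
     \<Rightarrow> fseq \<times> fseq \<times> real" where
  "acg_triple n \<psi>s D\<psi>s \<psi>n \<mu> L x0 j =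
    (let (A, x, y, \<Gamma>) = acg_state n \<psi>s D\<psi>s \<psi>n \<mu> L x0 j;
         u = (1 / A) *\<^sub>R (x0 - y);
         \<eta> = \<psi>s x + real_of_ereal (\<psi>n x) - \<Gamma> y - real_of_ereal (\<psi>n y) - u \<bullet> (x - y)
     in (x, u, \<eta>))"

text \<open>The ACG triples of the prox subproblem with prox center \<open>c\<close>.\<close>

definition aipp_triple ::
  "nat \<Rightarrow> (fseq \<Rightarrow> real) \<Rightarrow> (fseq \<Rightarrow> fseq) \<Rightarrow> (fseq \<Rightarrow> ereal) \<Rightarrow> real \<Rightarrow> real \<Rightarrow> fseq \<Rightarrow> nat
     \<Rightarrow> fseq \<times> fseq \<times> real" where
  "aipp_triple n g Dg h M lam c =
     acg_triple n
       (\<lambda>x. lam * g x + 1 / 4 * (norm (x - c))\<^sup>2)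
       (\<lambda>x. lam *\<^sub>R Dg x + (1 / 2) *\<^sub>R (x - c))
       (\<lambda>x. ereal lam * h x + ereal (1 / 4 * (norm (x - c))\<^sup>2))
       (1 / 2) (lam * M + 1 / 2) c"

definition accepted :: "real \<Rightarrow> fseq \<Rightarrow> fseq \<times> fseq \<times> real \<Rightarrow> bool" where
  "accepted \<sigma> c = (\<lambda>(x, u, \<eta>). (norm u)\<^sup>2 + 2 * \<eta> \<le> \<sigma> * (norm (c - x + u))\<^sup>2)"

definition first_from :: "nat \<Rightarrow> (nat \<Rightarrow> bool) \<Rightarrow> nat \<Rightarrow> bool" where
  "first_from k P j \<longleftrightarrow> k \<le> j \<and> P j \<and> (\<forall>i. k \<le> i \<and> i < j \<longrightarrow> \<not> P i)"

text \<open>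
  \<open>aipp n g Dg h M \<sigma> \<lambda> \<rho> \<epsilon> c N out\<close>: from the prox center \<open>c\<close>, the method stops after exactly
  \<open>N\<close> further ACG iterations with output \<open>out\<close>. The relation being inductive, it can only hold if
  the run is finite. In \<open>finish\<close> the last ACG run is continued, so its \<open>j\<close> iterations
  are part of \<open>j'\<close>.
\<close>

inductive aipp ::
  "nat \<Rightarrow> (fseq \<Rightarrow> real) \<Rightarrow> (fseq \<Rightarrow> fseq) \<Rightarrow> (fseq \<Rightarrow> ereal) \<Rightarrow> real \<Rightarrow> real \<Rightarrow> real \<Rightarrow> real \<Rightarrow> real
     \<Rightarrow> fseq \<Rightarrow> nat \<Rightarrow> real \<times> fseq \<times> fseq \<times> fseq \<times> real \<Rightarrow> bool"
  for n g Dg h M \<sigma> lam \<rho> \<epsilon> where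
  finish:
    "first_from (nat \<lceil>6 * sqrt (2 * lam * M + 1)\<rceil>)
       (\<lambda>i. accepted \<sigma> c (aipp_triple n g Dg h M lam c i)) j \<Longrightarrow>
     aipp_triple n g Dg h M lam c j = (x, u, \<eta>) \<Longrightarrow>
     norm (c - x + u) \<le> lam * \<rho> / 5 \<Longrightarrow>
     first_from j
       (\<lambda>i. accepted \<sigma> c (aipp_triple n g Dg h M lam c i) \<and>
            snd (snd (aipp_triple n g Dg h M lam c i)) / lam \<le> \<epsilon>) j' \<Longrightarrow>
     aipp_triple n g Dg h M lam c j' = (x', u', \<eta>') \<Longrightarrow>
     aipp n g Dg h M \<sigma> lam \<rho> \<epsilon> c j' (lam, c, x', (1 / lam) *\<^sub>R u', \<eta>' / lam)"
| continue:
    "first_from (nat \<lceil>6 * sqrt (2 * lam * M + 1)\<rceil>)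
       (\<lambda>i. accepted \<sigma> c (aipp_triple n g Dg h M lam c i)) j \<Longrightarrow>
     aipp_triple n g Dg h M lam c j = (x, u, \<eta>) \<Longrightarrow>
     \<not> norm (c - x + u) \<le> lam * \<rho> / 5 \<Longrightarrow>
     aipp n g Dg h M \<sigma> lam \<rho> \<epsilon> x N out \<Longrightarrow>
     aipp n g Dg h M \<sigma> lam \<rho> \<epsilon> c (j + N) out"

lemma first_from_unique: "first_from k P i \<Longrightarrow> first_from k P j \<Longrightarrow> i = j"
  unfolding first_from_def by (metis linorder_neqE_nat)

lemma aipp_deterministic:
  assumes "aipp n g Dg h M \<sigma> lam \<rho> \<epsilon> c N out" and "aipp n g Dg h M \<sigma> lam \<rho> \<epsilon> c N' out'"
  shows "N = N' \<and> out = out'"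
  using assms
proof (induction arbitrary: N' out' rule: aipp.induct)
  case (finish c j x u \<eta> j' x' u' \<eta>')
  from finish.prems show ?case
  proof cases
    case finish2: (finish i y v \<theta> y' v' \<theta>')
    then have "i = j"
      using finish.hyps first_from_unique by blast
    then have "N' = j'"
      using finish2 finish.hyps first_from_unique by blast
    then show ?thesis
      using finish2 finish.hyps by auto
  next
    case (continue i y v \<theta> K)
    then have "i = j"
      using finish.hyps first_from_unique by blast
    then show ?thesis
      using continue finish.hyps by auto
  qed
next
  case (continue c j x u \<eta> N out)
  from continue.prems show ?case
  proof cases
    case (finish i y v \<theta> y' v' \<theta>')
    then have "i = j"
      using continue.hyps first_from_unique by blast
    then show ?thesis
      using finish continue.hyps by auto
  next
    case continue2: (continue i y v \<theta> K)
    then have "i = j"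
      using continue.hyps first_from_unique by blast
    then have "y = x"
      using continue2 continue.hyps by auto
    then show ?thesis
      using continue2 continue.IH \<open>i = j\<close> by blast
  qed
qed

definition prox_approx_solution ::
  "nat \<Rightarrow> (fseq \<Rightarrow> real) \<Rightarrow> (fseq \<Rightarrow> ereal) \<Rightarrow> real \<Rightarrow> real
     \<Rightarrow> real \<times> fseq \<times> fseq \<times> fseq \<times> real \<Rightarrow> bool" where
  "prox_approx_solution n g h \<rho>' \<epsilon>' = (\<lambda>(lam, zm, z, w, \<epsilon>).
     0 < lam \<and> zm \<in> Rn n \<and> z \<in> edom n (phi g h) \<and> 0 \<le> \<epsilon> \<and>
     w \<in> eps_subdiff n \<epsilon> (\<lambda>u. phi g h u + ereal (1 / (2 * lam) * (norm (u - zm))\<^sup>2)) z \<and>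
     norm ((1 / lam) *\<^sub>R (zm - z) + w) \<le> \<rho>' \<and>
     \<epsilon> \<le> \<epsilon>')"

definition R_const ::
  "nat \<Rightarrow> (fseq \<Rightarrow> real) \<Rightarrow> (fseq \<Rightarrow> ereal) \<Rightarrow> real \<Rightarrow> fseq \<Rightarrow> real \<Rightarrow> ereal" where
  "R_const n g h \<sigma> z0 lam =
     (INF u\<in>Rn n. ereal (1 / 2 * (norm (z0 - u))\<^sup>2)
                  + ereal ((1 - \<sigma>) * lam) * (phi g h u - phi_star n g h))"

definition log1_plus :: "real \<Rightarrow> real" where
  "log1_plus t = max (ln t) 1"

end

theory Submission
  imports Defs
begin

text \<open>The objective of a prox subproblem, \<open>lam * phi + 1/2 |x - c|^2\<close>, is the sum of a smooth convex part
  (since \<open>lam * m \<le> 1/2\<close>, half of the prox term compensates the nonconvexity of \<open>g\<close>) and a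
  \<open>1/2\<close>-strongly convex part. Three facts about the accelerated method on such a sum carry the proof.

  First, \<open>estimate_sequence\<close>: the weight \<open>A\<^sub>j\<close> times the objective at \<open>x\<^sub>j\<close> lies below the minimum of a
  model of the weighted objective. This makes \<open>u\<^sub>j\<close> an \<open>\<eta>\<^sub>j\<close>-subgradient at \<open>x\<^sub>j\<close> and bounds
  \<open>|A\<^sub>j u\<^sub>j + x\<^sub>j - c|^2 + 2 A\<^sub>j \<eta>\<^sub>j\<close> by \<open>|x\<^sub>j - c|^2\<close>. Thus \<open>u\<^sub>j\<close> and \<open>\<eta>\<^sub>j\<close> are small relative to the
  displacement \<open>x\<^sub>j - c\<close> as soon as \<open>A\<^sub>j\<close> is large.

  Second, \<open>A\<^sub>j\<close> grows at least like \<open>j^2 / (4 L)\<close>, so that Step 1 accepts an iterate once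
  \<open>A\<^sub>j \<ge> 8 / \<sigma>\<close>, that is after a number of iterations of order \<open>sqrt (lam * M + 1)\<close>. It also grows
  geometrically with rate \<open>1 + sqrt (1 / (2 L))\<close>; this gives the logarithmic cost of Step 3, where
  \<open>\<eta>\<close> has to fall below \<open>lam * \<epsilon>\<close>.

  Third, \<open>displacement_stable\<close>: continuing a run moves the iterate to at most four times its distance
  from the prox center. The prox residual was at most \<open>lam * \<rho> / 5\<close> when Step 3 began, and therefore
  stays below \<open>lam * \<rho>\<close> until the end, which gives the residual bound of the output, and
  \<open>\<eta>\<close> is at most \<open>lam * \<epsilon>\<close> as soon as the weight reaches \<open>lam * \<rho>^2 / \<epsilon>\<close>.

  The outer iterations are counted by descent: each accepted triple lowers \<open>lam * phi\<close> by at least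
  \<open>(1 - \<sigma>)/2\<close> times its squared residual (\<open>sufficient_descent\<close>), and this residual exceeds
  \<open>lam * \<rho> / 5\<close> in every outer iteration but the last. Applied from the start, this would bound the
  number of outer iterations through \<open>phi z\<^sub>0 - phi\<^sub>*\<close>. The better quantity \<open>R\<close>, which is an infimum over
  all points, appears because the first accepted point \<open>z\<^sub>1\<close> already satisfies
  \<open>(1 - \<sigma>) lam (phi z\<^sub>1 - phi\<^sub>*) \<le> R\<close> (\<open>R_const_lower\<close>), so descent is counted from \<open>z\<^sub>1\<close> on.\<close>

section \<open>Compactness in the coordinate subspaces\<close>

lemma subspace_Rn: "subspace (Rn n)"
  by (auto simp: subspace_def Rn_def zero_fseq.rep_eq plus_fseq.rep_eq scaleR_fseq.rep_eq)

lift_definition unit_seq :: "nat \<Rightarrow> fseq" is "\<lambda>k i. if i = k then 1 else 0" by simp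

lemma abs_coord_le_norm: "\<bar>coord x i\<bar> \<le> norm x"
proof -
  have fin: "finite {i. coord x i \<noteq> 0}"
    using coord[of x] by simp
  have "(coord x i)\<^sup>2 \<le> x \<bullet> x"
  proof (cases "coord x i = 0")
    case False
    then have "coord x i * coord x i \<le> (\<Sum>i | coord x i \<noteq> 0. coord x i * coord x i)"
      by (intro member_le_sum[where f="\<lambda>i. coord x i * coord x i"]) (use fin in auto)
    then show ?thesis by (simp add: inner_fseq_def power2_eq_square)
  qed simp
  then show ?thesis
    by (metis norm_eq_sqrt_inner real_sqrt_abs real_sqrt_le_iff)
qed

text \<open>The ambient space of finitely supported sequences is infinite-dimensional, so compactness of boxes is
  proved by adding one coordinate at a time: a box in dimension \<open>n + 1\<close> is the continuous image of the
  product of a box in dimension \<open>n\<close> and an interval.\<close>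

lemma compact_box: "compact {x \<in> Rn n. \<forall>i<n. \<bar>coord x i\<bar> \<le> r}"
proof (induction n)
  case 0
  have "{x \<in> Rn 0. \<forall>i<0. \<bar>coord x i\<bar> \<le> r} = {0}"
    by (auto simp: Rn_def zero_fseq.rep_eq coord_inject[symmetric] fun_eq_iff)
  then show ?case by simp
next
  case (Suc n)
  define B where "B = {x \<in> Rn n. \<forall>i<n. \<bar>coord x i\<bar> \<le> r}"
  define f where "f = (\<lambda>p :: fseq \<times> real. fst p + snd p *\<^sub>R unit_seq n)"
  have "x \<in> f ` (B \<times> {-r..r})" if x: "x \<in> Rn (Suc n)" "\<forall>i<Suc n. \<bar>coord x i\<bar> \<le> r" for x
  proof (rule image_eqI)
    show "x = f (x - coord x n *\<^sub>R unit_seq n, coord x n)" by (simp add: f_def)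
    have c: "coord (x - coord x n *\<^sub>R unit_seq n) i = (if i = n then 0 else coord x i)" for i
      by (simp add: minus_fseq.rep_eq scaleR_fseq.rep_eq unit_seq.rep_eq)
    have "x - coord x n *\<^sub>R unit_seq n \<in> B"
      using x unfolding B_def Rn_def mem_Collect_eq c by simp
    moreover have "\<bar>coord x n\<bar> \<le> r" using x by blast
    ultimately show "(x - coord x n *\<^sub>R unit_seq n, coord x n) \<in> B \<times> {-r..r}"
      by (simp add: abs_le_iff)
  qed
  moreover have "f p \<in> {x \<in> Rn (Suc n). \<forall>i<Suc n. \<bar>coord x i\<bar> \<le> r}"
    if p: "p \<in> B \<times> {-r..r}" for p
  proof -
    have c: "coord (f p) i = coord (fst p) i + (if i = n then snd p else 0)" for i
      by (simp add: f_def plus_fseq.rep_eq scaleR_fseq.rep_eq unit_seq.rep_eq)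
    have "fst p \<in> B" "\<bar>snd p\<bar> \<le> r" using p by auto
    then show ?thesis
      unfolding B_def Rn_def mem_Collect_eq c by (simp add: less_Suc_eq)
  qed
  ultimately have eq: "{x \<in> Rn (Suc n). \<forall>i<Suc n. \<bar>coord x i\<bar> \<le> r} = f ` (B \<times> {-r..r})"
    by blast
  have "continuous_on (B \<times> {-r..r}) f"
    unfolding f_def by (intro continuous_intros)
  moreover have "compact (B \<times> {-r..r})"
    using Suc unfolding B_def by (intro compact_Times compact_Icc)
  ultimately show ?case
    unfolding eq by (rule compact_continuous_image)
qed

lemma bounded_sequence_convergent_subsequence:
  assumes "\<And>i::nat. X i \<in> Rn n" and "\<And>i. norm (X i) \<le> r"
  obtains z s where "z \<in> Rn n" and "strict_mono s" and "(\<lambda>i. X (s i)) \<longlonglongrightarrow> z"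
proof -
  have "\<forall>i. X i \<in> {x \<in> Rn n. \<forall>i<n. \<bar>coord x i\<bar> \<le> r}"
    using assms abs_coord_le_norm order_trans by blast
  then obtain z s where "z \<in> {x \<in> Rn n. \<forall>i<n. \<bar>coord x i\<bar> \<le> r}" "strict_mono s" "(X \<circ> s) \<longlonglongrightarrow> z"
    by (rule seq_compactE[OF compact_imp_seq_compact[OF compact_box]])
  then show thesis by (intro that) (simp_all add: o_def)
qed

lemma lower_semicontinuous_sequence:
  assumes "lower_semicontinuous n f" and "z \<in> Rn n" and "\<And>i::nat. X i \<in> Rn n"
    and "X \<longlonglongrightarrow> z" and "y < f z"
  shows "\<forall>\<^sub>F i in sequentially. y < f (X i)"
proof -
  have "f z \<le> Liminf (at z within Rn n) f"
    using assms(1,2) unfolding lower_semicontinuous_def by blast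
  then have "\<forall>\<^sub>F x in at z within Rn n. y < f x"
    using \<open>y < f z\<close> unfolding le_Liminf_iff by blast
  then have "\<forall>\<^sub>F x in nhds z. x \<noteq> z \<longrightarrow> x \<in> Rn n \<longrightarrow> y < f x"
    unfolding eventually_at_filter .
  then have "\<forall>\<^sub>F i in sequentially. X i \<noteq> z \<longrightarrow> X i \<in> Rn n \<longrightarrow> y < f (X i)"
    using \<open>X \<longlonglongrightarrow> z\<close> unfolding filterlim_iff by blast
  then show ?thesis
    by (rule eventually_mono) (use \<open>y < f z\<close> assms(3) in blast)
qed

section \<open>Existence of minimizers\<close>

abbreviation rpart :: "(fseq \<Rightarrow> ereal) \<Rightarrow> fseq \<Rightarrow> real" where
  "rpart f x \<equiv> real_of_ereal (f x)"

lemma edom_value: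
  assumes "proper n f" and "x \<in> edom n f"
  shows "f x = ereal (rpart f x)"
  using assms by (cases "f x") (auto simp: proper_def edom_def)

lemma edom_compare:
  assumes "proper n f" and "x \<in> edom n f"
  shows "ereal b < f x \<longleftrightarrow> b < rpart f x" and "f x \<le> ereal b \<longleftrightarrow> rpart f x \<le> b"
  using assms by (cases "f x"; auto simp: proper_def edom_def)+

lemma convex_ereal_real:
  assumes "proper n f" and "convex_ereal n f" and "x \<in> edom n f" and "y \<in> edom n f"
    and "0 \<le> t" and "t \<le> 1"
  shows "(1 - t) *\<^sub>R x + t *\<^sub>R y \<in> edom n f"
    and "rpart f ((1 - t) *\<^sub>R x + t *\<^sub>R y) \<le> (1 - t) * rpart f x + t * rpart f y"
proof -
  have xy: "x \<in> Rn n" "y \<in> Rn n" using assms by (auto simp: edom_def)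
  have "f ((1 - t) *\<^sub>R x + t *\<^sub>R y) \<le> ereal (1 - t) * f x + ereal t * f y"
    using assms(2,5,6) xy unfolding convex_ereal_def by blast
  also have "\<dots> = ereal ((1 - t) * rpart f x + t * rpart f y)"
    by (subst edom_value[OF assms(1,3)], subst edom_value[OF assms(1,4)]) simp
  finally have le: "f ((1 - t) *\<^sub>R x + t *\<^sub>R y) \<le> ereal ((1 - t) * rpart f x + t * rpart f y)" .
  moreover have "(1 - t) *\<^sub>R x + t *\<^sub>R y \<in> Rn n"
    using xy by (intro subspace_add subspace_scale subspace_Rn)
  ultimately show d: "(1 - t) *\<^sub>R x + t *\<^sub>R y \<in> edom n f"
    by (auto simp: edom_def)
  show "rpart f ((1 - t) *\<^sub>R x + t *\<^sub>R y) \<le> (1 - t) * rpart f x + t * rpart f y"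
    using le edom_compare(2)[OF assms(1) d] by blast
qed

lemma bounded_below_on_ball:
  assumes "assmA1 n h" and "c \<in> edom n h"
  obtains B where "\<And>w. w \<in> edom n h \<Longrightarrow> norm (w - c) \<le> 1 \<Longrightarrow> - B \<le> rpart h w"
proof -
  have pr: "proper n h" and lsc: "lower_semicontinuous n h"
    using assms by (auto simp: assmA1_def)
  have "\<exists>B. \<forall>w. w \<in> edom n h \<and> norm (w - c) \<le> 1 \<longrightarrow> - B \<le> rpart h w"
  proof (rule ccontr)
    assume "\<not> ?thesis"
    then have "\<forall>B. \<exists>w. w \<in> edom n h \<and> norm (w - c) \<le> 1 \<and> rpart h w < - B"
      by (metis not_le)
    then have "\<forall>i::nat. \<exists>w. w \<in> edom n h \<and> norm (w - c) \<le> 1 \<and> rpart h w < - real i"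
      by blast
    then obtain X where X: "\<And>i. X i \<in> edom n h" "\<And>i. norm (X i - c) \<le> 1"
        "\<And>i::nat. rpart h (X i) < - real i"
      by metis
    have XR: "X i \<in> Rn n" for i using X(1) by (auto simp: edom_def)
    have XB: "norm (X i) \<le> 1 + norm c" for i
      using X(2)[of i] norm_triangle_sub[of "X i" c] by simp
    obtain z s where z: "z \<in> Rn n" "strict_mono s" "(\<lambda>i. X (s i)) \<longlonglongrightarrow> z"
      by (rule bounded_sequence_convergent_subsequence[OF XR XB])
    have "- \<infinity> < h z" using pr z by (auto simp: proper_def)
    then obtain b where b: "ereal b < h z"
      using ereal_dense2 by blast
    have "\<forall>\<^sub>F i in sequentially. ereal b < h (X (s i))"
      using lower_semicontinuous_sequence[OF lsc z(1) _ z(3) b] XR by blast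
    then obtain N where N: "\<And>i. i \<ge> N \<Longrightarrow> ereal b < h (X (s i))"
      by (auto simp: eventually_sequentially)
    obtain k where k: "real k \<ge> - b" using real_arch_simple by blast
    let ?i = "max N k"
    have "s ?i \<ge> k" using seq_suble[OF z(2), of ?i] by simp
    then have "rpart h (X (s ?i)) < b"
      using X(3)[of "s ?i"] k by simp
    moreover have "b < rpart h (X (s ?i))"
      using N[OF max.cobounded1, of k] edom_compare(1)[OF pr X(1)] by blast
    ultimately show False by simp
  qed
  then show thesis using that by blast
qed

text \<open>On the unit ball around a point of its domain, \<open>h\<close> is bounded below by semicontinuity;
  convexity along rays turns this into a lower bound that is linear in the distance.\<close>

lemma linear_minorant:
  assumes "assmA1 n h" and "c \<in> edom n h"
  obtains B where "B \<ge> 0" and "\<And>w. w \<in> edom n h \<Longrightarrow> - B * (1 + norm (w - c)) \<le> rpart h w"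
proof -
  have pr: "proper n h" and cv: "convex_ereal n h"
    using assms by (auto simp: assmA1_def)
  obtain B where B: "\<And>w. w \<in> edom n h \<Longrightarrow> norm (w - c) \<le> 1 \<Longrightarrow> - B \<le> rpart h w"
    using bounded_below_on_ball[OF assms] by blast
  define H where "H = rpart h c"
  define K where "K = \<bar>B\<bar> + \<bar>H\<bar>"
  have K: "0 \<le> K" "B \<le> K" by (auto simp: K_def)
  have "- K * (1 + norm (w - c)) \<le> rpart h w" if w: "w \<in> edom n h" for w
  proof (cases "norm (w - c) \<le> 1")
    case True
    have "0 \<le> K * norm (w - c)" using K by simp
    then show ?thesis using B[OF w True] K(2) by (simp add: algebra_simps)
  next
    case False
    define d where "d = norm (w - c)"
    define t where "t = 1 / d"
    have d: "d > 1" using False by (simp add: d_def)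
    then have t: "0 \<le> t" "t \<le> 1" "t * d = 1" by (auto simp: t_def)
    let ?p = "(1 - t) *\<^sub>R c + t *\<^sub>R w"
    have "?p - c = t *\<^sub>R (w - c)" by (simp add: algebra_simps)
    then have "norm (?p - c) \<le> 1" using t by (simp add: d_def)
    then have "- B \<le> (1 - t) * H + t * rpart h w"
      unfolding H_def using B[of ?p] convex_ereal_real[OF pr cv assms(2) w t(1,2)] by linarith
    then have "d * (- B) \<le> d * ((1 - t) * H + t * rpart h w)"
      using d by (intro mult_left_mono) auto
    also have "\<dots> = (d - 1) * H + rpart h w"
    proof -
      have "d * (1 - t) = d - 1" "d * t = 1" using t(3) by (simp_all add: algebra_simps)
      then show ?thesis by (simp only: distrib_left mult.assoc[symmetric] mult_1)
    qed
    finally have "- (d * B) - (d - 1) * H \<le> rpart h w" by simp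
    moreover have "d * B \<le> d * \<bar>B\<bar>" using d by (intro mult_left_mono) auto
    moreover have "(d - 1) * H \<le> (d - 1) * \<bar>H\<bar>"
      using d by (intro mult_left_mono) auto
    ultimately have "- (d * \<bar>B\<bar>) - (d - 1) * \<bar>H\<bar> \<le> rpart h w" by linarith
    moreover have "- K * (1 + d) = - (d * \<bar>B\<bar>) - (d - 1) * \<bar>H\<bar> - (\<bar>B\<bar> + 2 * \<bar>H\<bar>)"
      by (simp add: K_def algebra_simps)
    ultimately show ?thesis
      unfolding d_def[symmetric] by linarith
  qed
  then show thesis by (rule that[OF K(1)])
qed

text \<open>A function that grows quadratically dominates the linear lower bound of \<open>h\<close>, so minimizing sequences
  are bounded. Semicontinuity is used along a convergent subsequence for \<open>h\<close> alone, after the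
  continuous part \<open>k\<close> has been subtracted; this also shows that the limit lies in the domain.\<close>

lemma minimizer_exists:
  assumes A1: "assmA1 n h" and c: "c \<in> edom n h" and lam: "0 < lam" and a: "0 < a"
    and cont: "\<And>z. isCont k z"
    and k: "\<And>w. a * (norm (w - c))\<^sup>2 - b * norm (w - c) - e \<le> k w"
  obtains z where "z \<in> edom n h"
    and "\<And>w. w \<in> edom n h \<Longrightarrow> lam * rpart h z + k z \<le> lam * rpart h w + k w"
proof -
  have pr: "proper n h" and lsc: "lower_semicontinuous n h"
    using A1 by (auto simp: assmA1_def)
  obtain B where B: "B \<ge> 0" "\<And>w. w \<in> edom n h \<Longrightarrow> - B * (1 + norm (w - c)) \<le> rpart h w"
    using linear_minorant[OF A1 c] by blast
  define F where "F w = lam * rpart h w + k w" for w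
  define b' e' where "b' = \<bar>b + lam * B\<bar>" and "e' = \<bar>e + lam * B\<bar>"
  have low: "a * (norm (w - c))\<^sup>2 - b' * norm (w - c) - e' \<le> F w" if w: "w \<in> edom n h" for w
  proof -
    have "lam * (- B * (1 + norm (w - c))) \<le> lam * rpart h w"
      using lam B(2)[OF w] by (intro mult_left_mono) auto
    moreover have "(b + lam * B) * norm (w - c) \<le> b' * norm (w - c)"
      unfolding b'_def by (intro mult_right_mono) auto
    moreover have "e + lam * B \<le> e'" unfolding e'_def by simp
    ultimately show ?thesis
      using k[of w] unfolding F_def by (simp add: algebra_simps)
  qed
  define I where "I = Inf (F ` edom n h)"
  have "bdd_below (F ` edom n h)"
  proof (rule bdd_belowI2)
    fix w assume w: "w \<in> edom n h"
    let ?t = "norm (w - c)"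
    have "0 \<le> a * (?t - b' / (2 * a))\<^sup>2" using a by simp
    also have "\<dots> = a * ?t\<^sup>2 - b' * ?t + b'\<^sup>2 / (4 * a)"
      using a by (simp add: field_simps power2_eq_square)
    finally show "- (b'\<^sup>2 / (4 * a)) - e' \<le> F w" using low[OF w] by linarith
  qed
  then have I_le: "I \<le> F w" if "w \<in> edom n h" for w
    unfolding I_def using that by (intro cInf_lower) auto
  have "\<exists>w\<in>edom n h. F w < I + inverse (real (Suc i))" for i
  proof -
    have "I < I + inverse (real (Suc i))" by simp
    then have "\<exists>y\<in>F ` edom n h. y < I + inverse (real (Suc i))"
      unfolding I_def using c by (intro cInf_lessD) auto
    then show ?thesis by blast
  qed
  then obtain X where X: "\<And>i. X i \<in> edom n h" "\<And>i. F (X i) < I + inverse (real (Suc i))"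
    by metis
  have XR: "X i \<in> Rn n" for i using X(1)[of i] by (simp add: edom_def)
  \<comment> \<open>Beyond distance \<open>T\<close> from \<open>c\<close> the quadratic lower bound exceeds \<open>I + 1\<close>.\<close>
  define T where "T = (b' + e' + \<bar>I\<bar> + 1) / a + 1"
  have nonneg: "0 \<le> b'" "0 \<le> e'" by (auto simp: b'_def e'_def)
  have T1: "1 \<le> T" unfolding T_def using nonneg a by simp
  have XT: "norm (X i - c) \<le> T" for i
  proof (rule ccontr)
    let ?t = "norm (X i - c)"
    assume "\<not> ?t \<le> T"
    then have t: "T < ?t" by simp
    have "F (X i) < I + 1"
      using X(2)[of i] inverse_le_1_iff[of "real (Suc i)"] by linarith
    have "(b' + e' + \<bar>I\<bar> + 1) * ?t \<le> (a * ?t) * ?t"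
    proof (rule mult_right_mono)
      have "a * T \<le> a * ?t" using t a by (intro mult_left_mono) auto
      moreover have "a * T = b' + e' + \<bar>I\<bar> + 1 + a" using a by (simp add: T_def field_simps)
      ultimately show "b' + e' + \<bar>I\<bar> + 1 \<le> a * ?t" using a by linarith
    qed simp
    moreover have "(e' + \<bar>I\<bar> + 1) * 1 \<le> (e' + \<bar>I\<bar> + 1) * ?t"
      using nonneg t T1 by (intro mult_left_mono) auto
    ultimately have "e' + \<bar>I\<bar> + 1 + b' * ?t \<le> a * ?t\<^sup>2"
      by (simp add: algebra_simps power2_eq_square)
    then show False using low[OF X(1)[of i]] \<open>F (X i) < I + 1\<close> by linarith
  qed
  have XB: "norm (X i) \<le> T + norm c" for i
    using XT[of i] norm_triangle_sub[of "X i" c] by linarith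
  obtain z s where z: "z \<in> Rn n" and s: "strict_mono s" and lim: "(\<lambda>i. X (s i)) \<longlonglongrightarrow> z"
    by (rule bounded_sequence_convergent_subsequence[OF XR XB])
  have "(\<lambda>i. F (X i)) \<longlonglongrightarrow> I"
  proof (rule tendsto_sandwich)
    show "\<forall>\<^sub>F i in sequentially. I \<le> F (X i)" using I_le X(1) by simp
    show "\<forall>\<^sub>F i in sequentially. F (X i) \<le> I + inverse (real (Suc i))"
      using X(2) by (intro always_eventually allI less_imp_le)
    show "(\<lambda>i. I + inverse (real (Suc i))) \<longlonglongrightarrow> I"
      using LIMSEQ_inverse_real_of_nat_add .
  qed simp
  then have "(\<lambda>i. F (X (s i))) \<longlonglongrightarrow> I"
    using LIMSEQ_subseq_LIMSEQ[OF _ s] by (simp add: o_def)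
  moreover have "(\<lambda>i. k (X (s i))) \<longlonglongrightarrow> k z"
    using isCont_tendsto_compose[OF cont lim] .
  ultimately have "(\<lambda>i. (F (X (s i)) - k (X (s i))) / lam) \<longlonglongrightarrow> (I - k z) / lam"
    using lam by (intro tendsto_intros) auto
  then have hlim: "(\<lambda>i. rpart h (X (s i))) \<longlonglongrightarrow> (I - k z) / lam"
    using lam by (simp add: F_def)
  have hz: "h z \<le> ereal ((I - k z) / lam)"
  proof (rule ccontr)
    assume "\<not> ?thesis"
    then have "ereal ((I - k z) / lam) < h z" by simp
    then obtain y where y: "ereal ((I - k z) / lam) < ereal y" "ereal y < h z"
      using ereal_dense2 by blast
    have "\<forall>\<^sub>F i in sequentially. ereal y < h (X (s i))"
      by (rule lower_semicontinuous_sequence[OF lsc z XR lim y(2)])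
    then have "\<forall>\<^sub>F i in sequentially. y \<le> rpart h (X (s i))"
      by (rule eventually_mono) (simp add: edom_compare(1)[OF pr X(1)])
    then have "y \<le> (I - k z) / lam"
      using tendsto_lowerbound[OF hlim] by simp
    then show False using y(1) by simp
  qed
  then have zD: "z \<in> edom n h" using z by (auto simp: edom_def)
  have "rpart h z \<le> (I - k z) / lam"
    using hz edom_compare(2)[OF pr zD] by blast
  then have "F z \<le> I"
    using lam by (simp add: F_def field_simps)
  then have "F z \<le> F w" if "w \<in> edom n h" for w
    using I_le[OF that] by linarith
  then show thesis using that[OF zD] by (simp add: F_def)
qed

section \<open>The accelerated composite gradient method\<close>

text \<open>Compare the minimum with the value at a point at fraction \<open>t\<close> of the segment to \<open>w\<close>, divide by \<open>t\<close>
  and let \<open>t\<close> tend to zero.\<close>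

lemma strongly_convex_growth:
  fixes F :: "'a::real_inner \<Rightarrow> real"
  assumes min: "\<And>w. w \<in> D \<Longrightarrow> F y \<le> F w" and "convex D" and "y \<in> D" "w \<in> D"
    and sc: "\<And>t. 0 < t \<Longrightarrow> t < 1 \<Longrightarrow>
      F ((1 - t) *\<^sub>R y + t *\<^sub>R w) \<le> (1 - t) * F y + t * F w - \<nu> / 2 * (t * (1 - t)) * (norm (w - y))\<^sup>2"
  shows "F y + \<nu> / 2 * (norm (w - y))\<^sup>2 \<le> F w"
proof -
  have "\<nu> / 2 * (norm (w - y))\<^sup>2 \<le> F w - F y"
  proof (rule field_le_mult_one_interval)
    fix s :: real assume s: "0 < s" "s < 1"
    define t where "t = 1 - s"
    have t: "0 < t" "t < 1" using s by (auto simp: t_def)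
    have "(1 - t) *\<^sub>R y + t *\<^sub>R w \<in> D"
      using assms(2-4) t by (intro convexD) auto
    from min[OF this] sc[OF t]
    have "F y \<le> (1 - t) * F y + t * F w - \<nu> / 2 * (t * (1 - t)) * (norm (w - y))\<^sup>2" by linarith
    then have "t * (s * (\<nu> / 2 * (norm (w - y))\<^sup>2)) \<le> t * (F w - F y)"
      unfolding t_def by (simp add: algebra_simps)
    then show "s * (\<nu> / 2 * (norm (w - y))\<^sup>2) \<le> F w - F y"
      using t by simp
  qed
  then show ?thesis by simp
qed

lemma norm_convex_combination:
  fixes a b :: "'a::real_inner"
  shows "(norm ((1 - t) *\<^sub>R a + t *\<^sub>R b))\<^sup>2
    = (1 - t) * (norm a)\<^sup>2 + t * (norm b)\<^sup>2 - t * (1 - t) * (norm (b - a))\<^sup>2"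
  by (simp add: power2_norm_eq_inner inner_simps inner_commute algebra_simps)

text \<open>The weights do not depend on the iterates; treating them alone gives their positivity, which is
  needed before the iterates are known to exist.\<close>

locale acg_weights =
  fixes \<mu> L :: real and A :: "nat \<Rightarrow> real"
  assumes mu_nonneg: "0 \<le> \<mu>" and L_pos: "0 < L" and A0: "A 0 = 0"
    and A_Suc: "\<And>j. A (Suc j) = A j + (\<mu> * A j + 1 + sqrt ((\<mu> * A j + 1)\<^sup>2 + 4 * L * (\<mu> * A j + 1) * A j)) / (2 * L)"
begin

definition stepsize :: "nat \<Rightarrow> real" where
  "stepsize j = A (Suc j) - A j"

lemma stepsize_eq:
  "stepsize j = (\<mu> * A j + 1 + sqrt ((\<mu> * A j + 1)\<^sup>2 + 4 * L * (\<mu> * A j + 1) * A j)) / (2 * L)"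
  using A_Suc[of j] by (simp add: stepsize_def)

lemma A_nonneg: "0 \<le> A j"
proof (induction j)
  case (Suc j)
  have "0 \<le> stepsize j"
    unfolding stepsize_eq using Suc mu_nonneg L_pos by simp
  then show ?case using Suc by (simp add: stepsize_def)
qed (simp add: A0)

lemma stepsize_pos: "0 < stepsize j"
proof -
  have "0 < \<mu> * A j + 1" using mu_nonneg A_nonneg[of j] by (simp add: add_nonneg_pos)
  moreover have "0 \<le> sqrt ((\<mu> * A j + 1)\<^sup>2 + 4 * L * (\<mu> * A j + 1) * A j)"
    using mu_nonneg A_nonneg[of j] L_pos by simp
  ultimately have "0 < \<mu> * A j + 1 + sqrt ((\<mu> * A j + 1)\<^sup>2 + 4 * L * (\<mu> * A j + 1) * A j)"
    by (rule add_pos_nonneg)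
  then show ?thesis
    unfolding stepsize_eq using L_pos by (intro divide_pos_pos) simp_all
qed

lemma A_Suc_eq: "A (Suc j) = A j + stepsize j"
  by (simp add: stepsize_def)

lemma A_Suc_pos: "0 < A (Suc j)"
  using A_nonneg[of j] stepsize_pos[of j] by (simp add: A_Suc_eq)

lemma A_pos: "1 \<le> j \<Longrightarrow> 0 < A j"
  using A_Suc_pos[of "j - 1"] by simp

lemma A_mono: "i \<le> j \<Longrightarrow> A i \<le> A j"
  by (rule lift_Suc_mono_le) (use stepsize_pos in \<open>simp_all add: A_Suc_eq less_imp_le\<close>)

text \<open>The step size is the positive root of this quadratic equation. It balances the curvature
  \<open>L / 2\<close> of the smooth part against the strong convexity of the model in \<open>estimate_sequence\<close>.\<close>

lemma stepsize_quadratic: "L * (stepsize j)\<^sup>2 = (\<mu> * A j + 1) * A (Suc j)"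
proof -
  define p where "p = \<mu> * A j + 1"
  define q where "q = sqrt (p\<^sup>2 + 4 * L * p * A j)"
  have "0 \<le> p" unfolding p_def using mu_nonneg A_nonneg[of j] by simp
  then have "q\<^sup>2 = p\<^sup>2 + 4 * L * p * A j"
    unfolding q_def using L_pos A_nonneg[of j] by simp
  moreover have "stepsize j = (p + q) / (2 * L)" unfolding stepsize_eq p_def q_def ..
  then have "2 * L * stepsize j - p = q" using L_pos by (simp add: field_simps)
  ultimately have "(2 * L * stepsize j - p)\<^sup>2 = p\<^sup>2 + 4 * L * p * A j" by simp
  then have "4 * L * (L * (stepsize j)\<^sup>2) = 4 * L * (p * (A j + stepsize j))"
    by (simp add: power2_eq_square algebra_simps)
  then show ?thesis using L_pos by (simp add: p_def A_Suc_eq)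
qed

text \<open>The equivalent claim that \<open>sqrt (A j)\<close> grows by at least \<open>1 / (2 * sqrt L)\<close> per step is
  preserved by the recursion.\<close>

lemma A_growth_quadratic: "(real j)\<^sup>2 / (4 * L) \<le> A j"
proof -
  have "real j / (2 * sqrt L) \<le> sqrt (A j)"
  proof (induction j)
    case (Suc j)
    define p where "p = \<mu> * A j + 1"
    have p: "1 \<le> p" unfolding p_def using mu_nonneg A_nonneg[of j] by simp
    have "(2 * sqrt L * sqrt (A j))\<^sup>2 \<le> p\<^sup>2 + 4 * L * p * A j"
    proof -
      have "4 * L * 1 * A j \<le> 4 * L * p * A j"
        using p L_pos A_nonneg[of j] by (intro mult_right_mono mult_left_mono) auto
      moreover have "(2 * sqrt L * sqrt (A j))\<^sup>2 = 4 * L * 1 * A j"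
        using L_pos A_nonneg[of j] by (simp add: power_mult_distrib)
      moreover have "0 \<le> p\<^sup>2" by simp
      ultimately show ?thesis by linarith
    qed
    then have "2 * sqrt L * sqrt (A j) \<le> sqrt (p\<^sup>2 + 4 * L * p * A j)"
      by (rule real_le_rsqrt)
    then have "(1 + 2 * sqrt L * sqrt (A j)) / (2 * L) \<le> stepsize j"
      unfolding stepsize_eq p_def[symmetric] using p L_pos by (intro divide_right_mono) auto
    moreover have "(sqrt (A j) + 1 / (2 * sqrt L))\<^sup>2 = A j + (1 / 2 + 2 * sqrt L * sqrt (A j)) / (2 * L)"
    proof -
      have "(b + 1 / (2 * l))\<^sup>2 = b * b + (1 / 2 + 2 * l * b) / (2 * (l * l))" if "0 < l" for b l :: real
        using that by (simp add: field_simps power2_eq_square)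
      from this[of "sqrt L" "sqrt (A j)"] show ?thesis using L_pos A_nonneg[of j] by simp
    qed
    moreover have "(1 / 2 + 2 * sqrt L * sqrt (A j)) / (2 * L) \<le> (1 + 2 * sqrt L * sqrt (A j)) / (2 * L)"
      using L_pos by (intro divide_right_mono) auto
    ultimately have "(sqrt (A j) + 1 / (2 * sqrt L))\<^sup>2 \<le> A (Suc j)"
      unfolding A_Suc_eq by linarith
    then have "sqrt (A j) + 1 / (2 * sqrt L) \<le> sqrt (A (Suc j))"
      by (rule real_le_rsqrt)
    moreover have "real (Suc j) / (2 * sqrt L) = real j / (2 * sqrt L) + 1 / (2 * sqrt L)"
      by (simp add: add_divide_distrib)
    ultimately show ?case using Suc by linarith
  qed (simp add: A0)
  then have "(real j / (2 * sqrt L))\<^sup>2 \<le> (sqrt (A j))\<^sup>2"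
    using L_pos by (intro power_mono) auto
  then show ?thesis
    using L_pos A_nonneg[of j] by (simp add: power_divide power_mult_distrib)
qed

text \<open>Under the root in the step size, the term \<open>4 * L * \<mu> * (A j)^2\<close> alone contributes
  \<open>A j * sqrt (\<mu> / L)\<close> to the step.\<close>

lemma A_growth_geometric: "A i * (1 + sqrt (\<mu> / L)) ^ s \<le> A (i + s)"
proof (induction s)
  case (Suc s)
  let ?B = "A (i + s)"
  have B: "0 \<le> ?B" by (rule A_nonneg)
  have "\<mu> * L = L\<^sup>2 * (\<mu> / L)" using L_pos by (simp add: power2_eq_square)
  then have "sqrt (\<mu> * L) = L * sqrt (\<mu> / L)"
    using L_pos by (simp only: real_sqrt_mult real_sqrt_abs abs_of_pos)
  then have "2 * L * (?B * sqrt (\<mu> / L)) = 2 * ?B * sqrt (\<mu> * L)" by simp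
  also have "\<dots> \<le> sqrt ((\<mu> * ?B + 1)\<^sup>2 + 4 * L * (\<mu> * ?B + 1) * ?B)"
  proof (rule real_le_rsqrt)
    have "(2 * ?B * sqrt (\<mu> * L))\<^sup>2 = 4 * L * (\<mu> * ?B) * ?B"
      using L_pos mu_nonneg by (simp add: power_mult_distrib power2_eq_square)
    also have "\<dots> \<le> 4 * L * (\<mu> * ?B + 1) * ?B"
      using L_pos B by (intro mult_right_mono mult_left_mono) auto
    finally show "(2 * ?B * sqrt (\<mu> * L))\<^sup>2 \<le> (\<mu> * ?B + 1)\<^sup>2 + 4 * L * (\<mu> * ?B + 1) * ?B"
      by (smt (verit) zero_le_power2)
  qed
  also have "\<dots> \<le> 2 * L * stepsize (i + s)"
    unfolding stepsize_eq using L_pos mu_nonneg B by simp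
  finally have "?B * sqrt (\<mu> / L) \<le> stepsize (i + s)" using L_pos by simp
  moreover have "A i * (1 + sqrt (\<mu> / L)) ^ s * (1 + sqrt (\<mu> / L)) \<le> ?B * (1 + sqrt (\<mu> / L))"
    using Suc.IH L_pos mu_nonneg by (intro mult_right_mono) auto
  ultimately show ?case
    by (simp add: A_Suc_eq algebra_simps)
qed simp

end

definition affine_function :: "('a::real_inner \<Rightarrow> real) \<Rightarrow> bool" where
  "affine_function G \<longleftrightarrow> (\<exists>v b. \<forall>w. G w = b + v \<bullet> w)"

lemma affine_function_average:
  assumes "affine_function G"
  shows "affine_function (\<lambda>w. p * G w + q * (a + d \<bullet> (w - z)))"
proof -
  obtain v b where "\<And>w. G w = b + v \<bullet> w"
    using assms unfolding affine_function_def by blast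
  then show ?thesis
    unfolding affine_function_def
    by (intro exI[of _ "p *\<^sub>R v + q *\<^sub>R d"] exI[of _ "p * b + q * (a - d \<bullet> z)"])
      (simp add: inner_simps algebra_simps)
qed

text \<open>A run of the method on a convex domain \<open>D\<close> with finite values. Only the behaviour of the smooth part
  \<open>fs\<close> on \<open>D\<close> enters, through the two sides of its quadratic approximation by \<open>Df\<close>; the minimality of
  \<open>y\<close> is assumed here and supplied for the concrete subproblems later.\<close>

locale acg = acg_weights \<mu> L A
  for \<mu> L :: real and A :: "nat \<Rightarrow> real" +
  fixes D :: "'a::real_inner set" and fs :: "'a \<Rightarrow> real" and Df :: "'a \<Rightarrow> 'a" and fn :: "'a \<Rightarrow> real"
    and c :: 'a and x y :: "nat \<Rightarrow> 'a" and \<Gamma> :: "nat \<Rightarrow> 'a \<Rightarrow> real"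
  assumes convex_D: "convex D" and c_D: "c \<in> D"
    and fs_lower: "\<And>z w. z \<in> D \<Longrightarrow> w \<in> D \<Longrightarrow> fs z + Df z \<bullet> (w - z) \<le> fs w"
    and fs_upper: "\<And>z w. z \<in> D \<Longrightarrow> w \<in> D \<Longrightarrow> fs w \<le> fs z + Df z \<bullet> (w - z) + L / 2 * (norm (w - z))\<^sup>2"
    and fn_strong: "\<And>z w t. z \<in> D \<Longrightarrow> w \<in> D \<Longrightarrow> 0 \<le> t \<Longrightarrow> t \<le> 1 \<Longrightarrow>
      fn ((1 - t) *\<^sub>R z + t *\<^sub>R w) \<le> (1 - t) * fn z + t * fn w - \<mu> / 2 * (t * (1 - t)) * (norm (w - z))\<^sup>2"
    and x0: "x 0 = c" and y0: "y 0 = c" and Gamma0: "\<And>w. \<Gamma> 0 w = 0"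
    and Gamma_Suc: "\<And>j w. \<Gamma> (Suc j) w = A j / A (Suc j) * \<Gamma> j w + (A (Suc j) - A j) / A (Suc j) *
      (fs ((A j / A (Suc j)) *\<^sub>R x j + ((A (Suc j) - A j) / A (Suc j)) *\<^sub>R y j) +
       Df ((A j / A (Suc j)) *\<^sub>R x j + ((A (Suc j) - A j) / A (Suc j)) *\<^sub>R y j) \<bullet>
         (w - ((A j / A (Suc j)) *\<^sub>R x j + ((A (Suc j) - A j) / A (Suc j)) *\<^sub>R y j)))"
    and y_Suc: "\<And>j. y (Suc j) \<in> D"
    and y_min: "\<And>j w. w \<in> D \<Longrightarrow>
      \<Gamma> (Suc j) (y (Suc j)) + fn (y (Suc j)) + 1 / (2 * A (Suc j)) * (norm (y (Suc j) - c))\<^sup>2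
      \<le> \<Gamma> (Suc j) w + fn w + 1 / (2 * A (Suc j)) * (norm (w - c))\<^sup>2"
    and x_Suc: "\<And>j. x (Suc j) = (A j / A (Suc j)) *\<^sub>R x j + ((A (Suc j) - A j) / A (Suc j)) *\<^sub>R y (Suc j)"
begin

definition xt :: "nat \<Rightarrow> 'a" where
  "xt j = (A j / A (Suc j)) *\<^sub>R x j + (stepsize j / A (Suc j)) *\<^sub>R y j"

lemma weights:
  "0 \<le> A j / A (Suc j)" "0 \<le> stepsize j / A (Suc j)" "A j / A (Suc j) + stepsize j / A (Suc j) = 1"
  using A_nonneg[of j] A_Suc_pos[of j] stepsize_pos[of j]
  by (simp_all add: A_Suc_eq add_divide_distrib[symmetric])

lemma y_D: "y j \<in> D"
  by (cases j) (auto simp: y0 c_D y_Suc)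

lemma x_D: "x j \<in> D"
proof (induction j)
  case (Suc j)
  show ?case unfolding x_Suc stepsize_def[symmetric]
    using convexD[OF convex_D Suc y_D weights] .
qed (simp add: x0 c_D)

lemma xt_D: "xt j \<in> D"
  unfolding xt_def using convexD[OF convex_D x_D y_D weights] .

lemma Gamma_scaled:
  "A (Suc j) * \<Gamma> (Suc j) w = A j * \<Gamma> j w + stepsize j * (fs (xt j) + Df (xt j) \<bullet> (w - xt j))"
  using Gamma_Suc[of j w] A_Suc_pos[of j]
  by (simp add: xt_def[symmetric] stepsize_def[symmetric] field_simps)

lemma Gamma_affine: "affine_function (\<Gamma> j)"
proof (induction j)
  case 0
  show ?case unfolding affine_function_def by (intro exI[of _ 0]) (simp add: Gamma0)
next
  case (Suc j)
  from affine_function_average[OF this] show ?case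
    unfolding Gamma_Suc[abs_def] .
qed

text \<open>The inequality is stated with the factor \<open>A j\<close> because \<open>\<Gamma> 0 = 0\<close> need not lie below \<open>fs\<close>.\<close>

lemma Gamma_below: "w \<in> D \<Longrightarrow> A j * \<Gamma> j w \<le> A j * fs w"
proof (induction j)
  case (Suc j)
  have "stepsize j * (fs (xt j) + Df (xt j) \<bullet> (w - xt j)) \<le> stepsize j * fs w"
    using fs_lower[OF xt_D Suc.prems] stepsize_pos[of j] by (intro mult_left_mono) auto
  then show ?case
    using Suc unfolding Gamma_scaled by (simp add: A_Suc_eq algebra_simps)
qed (simp add: A0)

definition f :: "'a \<Rightarrow> real" where
  "f w = fs w + fn w"

text \<open>The model is \<open>(\<mu> * A + 1)\<close>-strongly convex: \<open>\<mu> * A\<close> comes from \<open>fn\<close>, and \<open>1\<close> from the prox term.\<close>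

lemma model_growth:
  assumes "w \<in> D"
  shows "A (Suc j) * (\<Gamma> (Suc j) (y (Suc j)) + fn (y (Suc j))) + 1 / 2 * (norm (y (Suc j) - c))\<^sup>2
      + (\<mu> * A (Suc j) + 1) / 2 * (norm (w - y (Suc j)))\<^sup>2
    \<le> A (Suc j) * (\<Gamma> (Suc j) w + fn w) + 1 / 2 * (norm (w - c))\<^sup>2"
proof (rule strongly_convex_growth[OF _ convex_D y_D assms])
  let ?F = "\<lambda>w. A (Suc j) * (\<Gamma> (Suc j) w + fn w) + 1 / 2 * (norm (w - c))\<^sup>2"
  have eq: "?F w = A (Suc j) * (\<Gamma> (Suc j) w + fn w + 1 / (2 * A (Suc j)) * (norm (w - c))\<^sup>2)" for w
    using A_Suc_pos[of j] by (simp add: field_simps)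
  show "?F (y (Suc j)) \<le> ?F v" if "v \<in> D" for v
    unfolding eq using y_min[OF that] A_Suc_pos[of j] by (intro mult_left_mono) auto
  fix t :: real assume t: "0 < t" "t < 1"
  let ?a = "y (Suc j)" and ?A = "A (Suc j)" and ?G = "\<Gamma> (Suc j)"
  let ?p = "(1 - t) *\<^sub>R ?a + t *\<^sub>R w"
  obtain v b where vb: "\<And>w. ?G w = b + v \<bullet> w" using Gamma_affine unfolding affine_function_def by blast
  have G: "?G ?p = (1 - t) * ?G ?a + t * ?G w"
    by (simp add: vb inner_simps algebra_simps)
  have fn: "?A * fn ?p
      \<le> ?A * ((1 - t) * fn ?a + t * fn w - \<mu> / 2 * (t * (1 - t)) * (norm (w - ?a))\<^sup>2)"
    using fn_strong[OF y_D assms] t A_Suc_pos[of j] by (intro mult_left_mono) auto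
  have N: "(norm (?p - c))\<^sup>2 = (1 - t) * (norm (?a - c))\<^sup>2 + t * (norm (w - c))\<^sup>2
      - t * (1 - t) * (norm (w - ?a))\<^sup>2"
    using norm_convex_combination[of t "?a - c" "w - c"] by (simp add: algebra_simps)
  have "?F ?p = ?A * ?G ?p + ?A * fn ?p + 1 / 2 * (norm (?p - c))\<^sup>2"
    by (simp only: distrib_left)
  also have "\<dots> = ?A * ((1 - t) * ?G ?a + t * ?G w) + ?A * fn ?p
      + 1 / 2 * ((1 - t) * (norm (?a - c))\<^sup>2 + t * (norm (w - c))\<^sup>2
      - t * (1 - t) * (norm (w - ?a))\<^sup>2)"
    by (simp only: G N)
  also have "\<dots> \<le> ?A * ((1 - t) * ?G ?a + t * ?G w)
      + ?A * ((1 - t) * fn ?a + t * fn w - \<mu> / 2 * (t * (1 - t)) * (norm (w - ?a))\<^sup>2)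
      + 1 / 2 * ((1 - t) * (norm (?a - c))\<^sup>2 + t * (norm (w - c))\<^sup>2
      - t * (1 - t) * (norm (w - ?a))\<^sup>2)"
    by (intro add_mono order_refl fn)
  also have "\<dots> = (1 - t) * ?F ?a + t * ?F w
      - (\<mu> * ?A + 1) / 2 * (t * (1 - t)) * (norm (w - ?a))\<^sup>2"
    by (simp add: field_simps)
  finally show "?F ?p \<le> (1 - t) * ?F ?a + t * ?F w
      - (\<mu> * ?A + 1) / 2 * (t * (1 - t)) * (norm (w - ?a))\<^sup>2" .
qed

lemma fn_convex:
  assumes "z \<in> D" "w \<in> D" "0 \<le> p" "0 \<le> q" "p + q = 1"
  shows "fn (p *\<^sub>R z + q *\<^sub>R w) \<le> p * fn z + q * fn w"
proof -
  have p: "p = 1 - q" using assms by simp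
  have "0 \<le> \<mu> / 2 * (q * (1 - q)) * (norm (w - z))\<^sup>2"
    using assms mu_nonneg by (intro mult_nonneg_nonneg) auto
  moreover have "fn ((1 - q) *\<^sub>R z + q *\<^sub>R w)
      \<le> (1 - q) * fn z + q * fn w - \<mu> / 2 * (q * (1 - q)) * (norm (w - z))\<^sup>2"
    using assms by (intro fn_strong) auto
  ultimately have "fn ((1 - q) *\<^sub>R z + q *\<^sub>R w) \<le> (1 - q) * fn z + q * fn w" by linarith
  then show ?thesis by (simp only: p)
qed

text \<open>The central invariant. In the induction step the hypothesis is used at the new point \<open>y (Suc j)\<close>.
  The smooth part is linearized at \<open>xt j\<close>, where \<open>x (Suc j) - xt j\<close> is \<open>y (Suc j) - y j\<close> scaled by
  \<open>stepsize j / A (Suc j)\<close>; by \<open>stepsize_quadratic\<close> the linearization error is then exactly the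
  quadratic term of the hypothesis.\<close>

lemma estimate_sequence:
  assumes "w \<in> D"
  shows "A j * f (x j) + (\<mu> * A j + 1) / 2 * (norm (w - y j))\<^sup>2
    \<le> A j * (\<Gamma> j w + fn w) + 1 / 2 * (norm (w - c))\<^sup>2"
  using assms
proof (induction j arbitrary: w)
  case 0
  then show ?case by (simp add: A0 y0)
next
  case (Suc j)
  let ?A = "A j" and ?A' = "A (Suc j)" and ?a = "stepsize j" and ?y' = "y (Suc j)" and ?x' = "x (Suc j)"
  let ?l = "\<lambda>w. fs (xt j) + Df (xt j) \<bullet> (w - xt j)"
  have A': "0 < ?A'" by (rule A_Suc_pos)
  have step: "?A' * f ?x' \<le> ?A' * (\<Gamma> (Suc j) ?y' + fn ?y') + 1 / 2 * (norm (?y' - c))\<^sup>2"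
  proof -
    have x': "?x' = (?A / ?A') *\<^sub>R x j + (?a / ?A') *\<^sub>R ?y'"
      by (simp add: x_Suc stepsize_def)
    have diff: "?x' - xt j = (?a / ?A') *\<^sub>R (?y' - y j)"
      by (simp add: x' xt_def algebra_simps)
    have "?A' * fs ?x' \<le> ?A' * (?l ?x' + L / 2 * (norm (?x' - xt j))\<^sup>2)"
      using fs_upper[OF xt_D x_D[of "Suc j"], of j] A' by (intro mult_left_mono) auto
    also have "\<dots> = ?A' * ?l ?x' + (L * ?a\<^sup>2) / ?A' / 2 * (norm (?y' - y j))\<^sup>2"
    proof -
      have "(norm (?x' - xt j))\<^sup>2 = (?a / ?A')\<^sup>2 * (norm (?y' - y j))\<^sup>2"
        unfolding diff norm_scaleR power_mult_distrib power2_abs ..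
      then show ?thesis using A' by (simp add: field_simps power2_eq_square)
    qed
    also have "\<dots> = ?A' * ?l ?x' + (\<mu> * ?A + 1) / 2 * (norm (?y' - y j))\<^sup>2"
      using A' unfolding stepsize_quadratic by simp
    also have "?A' * ?l ?x' = ?A * ?l (x j) + ?a * ?l ?y'"
    proof -
      have "?A' *\<^sub>R ?x' = ?A *\<^sub>R x j + ?a *\<^sub>R ?y'"
        using A' by (simp add: x' algebra_simps)
      then have "?A' *\<^sub>R (?x' - xt j) = ?A *\<^sub>R (x j - xt j) + ?a *\<^sub>R (?y' - xt j)"
        by (simp add: A_Suc_eq algebra_simps)
      from arg_cong[OF this, of "\<lambda>v. Df (xt j) \<bullet> v"]
      have "?A' * (Df (xt j) \<bullet> (?x' - xt j))
          = ?A * (Df (xt j) \<bullet> (x j - xt j)) + ?a * (Df (xt j) \<bullet> (?y' - xt j))"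
        by (simp only: inner_add_right inner_scaleR_right)
      then show ?thesis by (simp add: A_Suc_eq algebra_simps)
    qed
    finally have "?A' * fs ?x'
      \<le> ?A * ?l (x j) + ?a * ?l ?y' + (\<mu> * ?A + 1) / 2 * (norm (?y' - y j))\<^sup>2" .
    moreover have "?A * ?l (x j) \<le> ?A * fs (x j)"
      using fs_lower[OF xt_D x_D] A_nonneg by (intro mult_left_mono) auto
    moreover have "?A' * fn ?x' \<le> ?A * fn (x j) + ?a * fn ?y'"
    proof -
      have "?A' * fn ?x' \<le> ?A' * (?A / ?A' * fn (x j) + ?a / ?A' * fn ?y')"
        unfolding x' using A' by (intro mult_left_mono fn_convex x_D y_D weights) auto
      also have "\<dots> = ?A * fn (x j) + ?a * fn ?y'" using A' by (simp add: distrib_left)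
      finally show ?thesis .
    qed
    moreover have "?A' * (\<Gamma> (Suc j) ?y' + fn ?y') = ?A * (\<Gamma> j ?y' + fn ?y') + ?a * ?l ?y' + ?a * fn ?y'"
      using Gamma_scaled[of j ?y'] by (simp add: A_Suc_eq algebra_simps)
    ultimately show ?thesis
      using Suc.IH[OF y_D[of "Suc j"]] by (simp add: f_def algebra_simps)
  qed
  then show ?case using model_growth[OF Suc.prems, of j] by linarith
qed

definition u :: "nat \<Rightarrow> 'a" where
  "u j = (1 / A j) *\<^sub>R (c - y j)"

definition \<eta> :: "nat \<Rightarrow> real" where
  "\<eta> j = f (x j) - \<Gamma> j (y j) - fn (y j) - u j \<bullet> (x j - y j)"

text \<open>The model has slope \<open>u j\<close> at its minimizer \<open>y j\<close> and lies below the objective. The strong convexity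
  that remains besides the subgradient inequality is centered at \<open>y j\<close>; it is what later controls
  the drift of the iterates.\<close>

lemma subgradient_growth:
  assumes "1 \<le> j" and "w \<in> D"
  shows "f (x j) + u j \<bullet> (w - x j) - \<eta> j + \<mu> / 2 * (norm (w - y j))\<^sup>2 \<le> f w"
proof -
  obtain i where j: "j = Suc i" using assms(1) by (cases j) auto
  let ?A = "A j" and ?y = "y j"
  have A: "0 < ?A" using A_pos assms(1) .
  have uA: "c - ?y = ?A *\<^sub>R u j" using A by (simp add: u_def)
  have "(norm (w - c))\<^sup>2 = (norm (?y - c))\<^sup>2 - 2 * ?A * (u j \<bullet> (w - ?y)) + (norm (w - ?y))\<^sup>2"
  proof -
    have "(norm (w - c))\<^sup>2 = (norm (?y - c))\<^sup>2 - 2 * ((c - ?y) \<bullet> (w - ?y)) + (norm (w - ?y))\<^sup>2"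
      by (simp add: power2_norm_eq_inner inner_simps inner_commute algebra_simps)
    then show ?thesis by (simp add: uA)
  qed
  with model_growth[OF assms(2), of i]
  have "?A * (\<Gamma> j ?y + fn ?y + u j \<bullet> (w - ?y) + \<mu> / 2 * (norm (w - ?y))\<^sup>2) \<le> ?A * (\<Gamma> j w + fn w)"
    unfolding j[symmetric] by (simp add: algebra_simps add_divide_distrib)
  also have "\<dots> \<le> ?A * f w"
    using Gamma_below[OF assms(2), of j] by (simp add: f_def algebra_simps)
  finally have "\<Gamma> j ?y + fn ?y + u j \<bullet> (w - ?y) + \<mu> / 2 * (norm (w - ?y))\<^sup>2 \<le> f w"
    using A by simp
  then show ?thesis
    by (simp add: \<eta>_def inner_simps algebra_simps)
qed

lemma eta_nonneg: "1 \<le> j \<Longrightarrow> 0 \<le> \<eta> j"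
proof -
  assume "1 \<le> j"
  from subgradient_growth[OF this x_D, of j] have "\<mu> / 2 * (norm (x j - y j))\<^sup>2 \<le> \<eta> j" by simp
  moreover have "0 \<le> \<mu> / 2 * (norm (x j - y j))\<^sup>2" using mu_nonneg by simp
  ultimately show ?thesis by linarith
qed

text \<open>As \<open>A j *\<^sub>R u j = c - y j\<close>, expanding the squares turns this into \<open>estimate_sequence\<close> at \<open>y j\<close>.\<close>

lemma residual_bound:
  assumes "1 \<le> j"
  shows "(norm (A j *\<^sub>R u j + x j - c))\<^sup>2 + 2 * A j * \<eta> j \<le> (norm (x j - c))\<^sup>2"
proof -
  let ?A = "A j" and ?y = "y j" and ?x = "x j"
  have A: "0 < ?A" using A_pos assms .
  have uA: "?A *\<^sub>R u j = c - ?y" using A by (simp add: u_def)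
  have "?A * \<eta> j = ?A * (f ?x - \<Gamma> j ?y - fn ?y) - (?A *\<^sub>R u j) \<bullet> (?x - ?y)"
    by (simp add: \<eta>_def algebra_simps)
  then have "2 * ?A * \<eta> j = 2 * (?A * (f ?x - \<Gamma> j ?y - fn ?y)) - 2 * ((c - ?y) \<bullet> (?x - ?y))"
    unfolding uA by linarith
  moreover have "2 * (?A * (f ?x - \<Gamma> j ?y - fn ?y)) \<le> (norm (?y - c))\<^sup>2"
    using estimate_sequence[OF y_D[of j], of j] by (simp add: algebra_simps)
  moreover have "(norm (?A *\<^sub>R u j + ?x - c))\<^sup>2 = (norm (?x - ?y))\<^sup>2"
    unfolding uA by (simp add: algebra_simps)
  moreover have "(norm (?x - c))\<^sup>2
      = (norm (?x - ?y))\<^sup>2 + (norm (?y - c))\<^sup>2 - 2 * ((c - ?y) \<bullet> (?x - ?y))"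
    by (simp add: power2_norm_eq_inner inner_simps inner_commute algebra_simps)
  ultimately show ?thesis by linarith
qed

lemma function_gap:
  assumes "w \<in> D"
  shows "A j * (f (x j) - f w) \<le> 1 / 2 * (norm (w - c))\<^sup>2"
proof -
  have "A j * (\<Gamma> j w + fn w) \<le> A j * f w"
    using Gamma_below[OF assms, of j] by (simp add: f_def algebra_simps)
  moreover have "0 \<le> (\<mu> * A j + 1) / 2 * (norm (w - y j))\<^sup>2"
    using mu_nonneg A_nonneg[of j] by simp
  ultimately have "A j * f (x j) - A j * f w \<le> 1 / 2 * (norm (w - c))\<^sup>2"
    using estimate_sequence[OF assms, of j] by linarith
  then show ?thesis by (simp only: right_diff_distrib)
qed

lemma u_bound:
  assumes "1 \<le> j"
  shows "norm (u j) \<le> 2 / A j * norm (x j - c)"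
proof -
  have A: "0 < A j" using A_pos assms .
  have "0 \<le> 2 * A j * \<eta> j" using A eta_nonneg[OF assms] by simp
  then have "(norm (A j *\<^sub>R u j + x j - c))\<^sup>2 \<le> (norm (x j - c))\<^sup>2"
    using residual_bound[OF assms] by linarith
  then have "norm (A j *\<^sub>R u j + (x j - c)) \<le> norm (x j - c)"
    by (simp add: add_diff_eq)
  moreover have "norm (A j *\<^sub>R u j) \<le> norm (A j *\<^sub>R u j + (x j - c)) + norm (x j - c)"
    using norm_triangle_ineq4[of "A j *\<^sub>R u j + (x j - c)" "x j - c"] by simp
  ultimately have "A j * norm (u j) \<le> 2 * norm (x j - c)" using A by simp
  then show ?thesis using A by (simp add: field_simps)
qed

lemma eta_bound:
  assumes "1 \<le> j"
  shows "\<eta> j \<le> (norm (x j - c))\<^sup>2 / (2 * A j)"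
proof -
  have A: "0 < A j" using A_pos assms .
  have "2 * A j * \<eta> j \<le> (norm (x j - c))\<^sup>2"
    using residual_bound[OF assms] by (smt (verit) zero_le_power2)
  then show ?thesis using A by (simp add: field_simps)
qed

text \<open>With \<open>r = |x j - c|\<close> and \<open>B = A j\<close>, the left side is at most \<open>(4 / B^2 + 1 / B) * r^2\<close> and the norm on the
  right is at least \<open>(1 - 2 / B) * r\<close>. The threshold \<open>8 / \<sigma>\<close> is chosen so that the resulting inequality
  \<open>4 + B \<le> \<sigma> * (B - 2)^2\<close> follows from \<open>B - 2 \<ge> B / 2\<close>.\<close>

lemma residual_dominates:
  assumes "1 \<le> j" and "0 < \<sigma>" and "\<sigma> < 1" and "8 / \<sigma> \<le> A j"
  shows "(norm (u j))\<^sup>2 + 2 * \<eta> j \<le> \<sigma> * (norm (c - x j + u j))\<^sup>2"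
proof -
  define r where "r = norm (x j - c)"
  define B where "B = A j"
  have "8 < 8 / \<sigma>" using assms(2,3) by (simp add: field_simps)
  then have B: "8 \<le> B" using assms(4) by (simp add: B_def)
  have "8 \<le> \<sigma> * B" using assms(2,4) by (simp add: B_def field_simps)
  have u: "norm (u j) \<le> 2 / B * r" using u_bound[OF assms(1)] by (simp add: B_def r_def)
  have "(norm (u j))\<^sup>2 \<le> (2 / B * r)\<^sup>2" using u by (intro power_mono) auto
  moreover have "2 * \<eta> j \<le> r\<^sup>2 / B" using eta_bound[OF assms(1)] by (simp add: B_def r_def)
  ultimately have "(norm (u j))\<^sup>2 + 2 * \<eta> j \<le> (4 / B\<^sup>2 + 1 / B) * r\<^sup>2"
    by (simp add: power_mult_distrib power_divide algebra_simps)
  also have "\<dots> \<le> (\<sigma> * (1 - 2 / B)\<^sup>2) * r\<^sup>2"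
  proof (rule mult_right_mono)
    have "4 + B \<le> 2 * B" using B by simp
    also have "\<dots> \<le> (\<sigma> * B / 4) * B" using \<open>8 \<le> \<sigma> * B\<close> B by (intro mult_right_mono) auto
    also have "\<dots> = \<sigma> * (B / 2)\<^sup>2" by (simp add: power2_eq_square)
    also have "\<dots> \<le> \<sigma> * (B - 2)\<^sup>2"
      using B assms(2) by (intro mult_left_mono power_mono) auto
    finally have "(4 + B) / B\<^sup>2 \<le> \<sigma> * (B - 2)\<^sup>2 / B\<^sup>2" by (rule divide_right_mono) simp
    moreover have "(4 + B) / B\<^sup>2 = 4 / B\<^sup>2 + 1 / B" using B by (simp add: field_simps power2_eq_square)
    moreover have "\<sigma> * (B - 2)\<^sup>2 / B\<^sup>2 = \<sigma> * (1 - 2 / B)\<^sup>2"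
    proof -
      have "1 - 2 / B = (B - 2) / B" using B by (simp add: diff_divide_distrib)
      then show ?thesis by (simp only: power_divide times_divide_eq_right)
    qed
    ultimately show "4 / B\<^sup>2 + 1 / B \<le> \<sigma> * (1 - 2 / B)\<^sup>2" by simp
  qed simp
  also have "\<dots> = \<sigma> * ((1 - 2 / B) * r)\<^sup>2" by (simp add: power_mult_distrib)
  also have "\<dots> \<le> \<sigma> * (norm (c - x j + u j))\<^sup>2"
  proof (intro mult_left_mono power_mono)
    have "r \<le> norm (c - x j + u j) + norm (u j)"
      using norm_triangle_ineq4[of "c - x j + u j" "u j"] by (simp add: r_def norm_minus_commute)
    then show "(1 - 2 / B) * r \<le> norm (c - x j + u j)" using u by (simp add: algebra_simps)
    show "0 \<le> (1 - 2 / B) * r" using B by (simp add: r_def)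
  qed (use assms in auto)
  finally show ?thesis .
qed

text \<open>Both iterates almost minimize the objective: \<open>function_gap\<close> shows that \<open>x i\<close> is hardly worse than \<open>x j\<close>,
  and \<open>subgradient_growth\<close> at \<open>j\<close> then forces \<open>x i\<close> to be close to \<open>y j\<close>, which is within twice the
  displacement of \<open>c\<close>. Comparing the two iterates directly avoids the exact minimizer of the
  subproblem.\<close>

lemma displacement_stable:
  assumes "1 \<le> j" and "j \<le> i" and "18 \<le> A j" and mu: "\<mu> = 1 / 2"
  shows "norm (x i - c) \<le> 4 * norm (x j - c)"
proof (rule ccontr)
  define r where "r = norm (x j - c)"
  define d where "d = norm (x i - c)"
  have r: "0 \<le> r" by (simp add: r_def)
  assume "\<not> ?thesis"
  then have d: "4 * r < d" by (simp add: r_def d_def)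
  have Ai: "18 \<le> A i" using A_mono[OF assms(2)] assms(3) by linarith
  have "A i * (f (x i) - f (x j)) \<le> r\<^sup>2 / 2" using function_gap[OF x_D[of j], of i] by (simp add: r_def)
  have gap: "f (x i) - f (x j) \<le> r\<^sup>2 / 36"
  proof (rule ccontr)
    assume n: "\<not> ?thesis"
    then have "A i * (r\<^sup>2 / 36) < A i * (f (x i) - f (x j))"
      using Ai by (intro mult_strict_left_mono) auto
    moreover have "18 * (r\<^sup>2 / 36) \<le> A i * (r\<^sup>2 / 36)"
      using Ai by (intro mult_right_mono) auto
    ultimately show False using \<open>A i * (f (x i) - f (x j)) \<le> r\<^sup>2 / 2\<close> by simp
  qed
  have u: "norm (u j) \<le> r / 9"
  proof -
    have "2 / A j * r \<le> 2 / 18 * r" using assms(3) r by (intro mult_right_mono divide_left_mono) auto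
    then show ?thesis using u_bound[OF assms(1)] by (simp add: r_def)
  qed
  have eta: "\<eta> j \<le> r\<^sup>2 / 36"
  proof -
    have "r\<^sup>2 / (2 * A j) \<le> r\<^sup>2 / (2 * 18)" using assms(3) by (intro divide_left_mono) auto
    then show ?thesis using eta_bound[OF assms(1)] by (simp add: r_def)
  qed
  have y: "norm (y j - c) \<le> 2 * r"
  proof -
    have A: "0 < A j" using assms(3) by simp
    have "norm (y j - c) = A j * norm (u j)" using A by (simp add: u_def norm_minus_commute)
    also have "\<dots> \<le> A j * (2 / A j * r)"
      using u_bound[OF assms(1)] A by (intro mult_left_mono) (auto simp: r_def)
    finally show ?thesis using A by simp
  qed
  have "f (x j) + u j \<bullet> (x i - x j) - \<eta> j + 1 / 4 * (norm (x i - y j))\<^sup>2 \<le> f (x i)"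
    using subgradient_growth[OF assms(1) x_D[of i]] by (simp add: mu)
  moreover have "- (u j \<bullet> (x i - x j)) \<le> r / 9 * (d + r)"
  proof -
    have "- (u j \<bullet> (x i - x j)) \<le> norm (u j) * norm (x i - x j)"
      using norm_cauchy_schwarz[of "- u j" "x i - x j"] by simp
    also have "\<dots> \<le> r / 9 * (d + r)"
      using u r norm_triangle_ineq4[of "x i - c" "x j - c"]
      by (intro mult_mono) (auto simp: d_def r_def)
    finally show ?thesis .
  qed
  moreover have "(d / 2)\<^sup>2 \<le> (norm (x i - y j))\<^sup>2"
    using norm_triangle_ineq2[of "x i - c" "y j - c"] y d r
    by (intro power_mono) (auto simp: d_def)
  ultimately have "d\<^sup>2 / 16 \<le> r\<^sup>2 / 18 + r / 9 * (d + r)"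
    using gap eta by (simp add: power_divide)
  moreover have "(4 * r) * d \<le> d * d" "(4 * r) * r \<le> d * r"
    using d r by (intro mult_right_mono; simp)+
  moreover have "0 \<le> r * r" by simp
  moreover have "0 < d * d" using d r by simp
  moreover have "9 * (d * d) \<le> 24 * (r * r) + 16 * (d * r)"
    using \<open>d\<^sup>2 / 16 \<le> r\<^sup>2 / 18 + r / 9 * (d + r)\<close>
    by (simp add: power2_eq_square field_simps)
  moreover have "4 * (d * r) \<le> d * d" "4 * (r * r) \<le> d * r"
    using \<open>(4 * r) * d \<le> d * d\<close> \<open>(4 * r) * r \<le> d * r\<close> by (simp_all add: ac_simps)
  ultimately show False by linarith
qed

end

section \<open>The proximal subproblems\<close>

lemma arg_min_on_attained:
  fixes F :: "'a \<Rightarrow> 'b::linorder"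
  assumes "z \<in> S" and "\<And>w. w \<in> S \<Longrightarrow> F z \<le> F w"
  shows "arg_min_on F S \<in> S" and "w \<in> S \<Longrightarrow> F (arg_min_on F S) \<le> F w"
proof -
  have "is_arg_min F (\<lambda>x. x \<in> S) z"
    using assms by (auto simp: is_arg_min_def not_less)
  then have "is_arg_min F (\<lambda>x. x \<in> S) (arg_min_on F S)"
    unfolding arg_min_on_def arg_min_def by (rule someI)
  then show "arg_min_on F S \<in> S" and "w \<in> S \<Longrightarrow> F (arg_min_on F S) \<le> F w"
    by (auto simp: is_arg_min_def not_less)
qed

lemma first_from_exists:
  assumes "P b" and "k \<le> b"
  shows "\<exists>j\<le>b. first_from k P j"
proof -
  let ?Q = "\<lambda>i. k \<le> i \<and> P i"
  have "?Q b" using assms by simp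
  then have "?Q (LEAST i. ?Q i)" "(LEAST i. ?Q i) \<le> b"
    by (rule LeastI, rule Least_le)
  moreover have "\<not> ?Q i" if "i < (LEAST i. ?Q i)" for i
    using not_less_Least[OF that] .
  ultimately show ?thesis unfolding first_from_def by blast
qed

text \<open>The prox subproblem splits the term \<open>1/2 |x - c|^2\<close> evenly: one half makes \<open>lam * g\<close> convex, as
  \<open>lam * m \<le> 1 / 2\<close>, the other half makes \<open>lam * h\<close> strongly convex with modulus \<open>1 / 2\<close>. On the domain
  \<open>D\<close> the extended-valued functions are replaced by their real parts.\<close>

locale prox_problem =
  fixes n :: nat and g :: "fseq \<Rightarrow> real" and Dg :: "fseq \<Rightarrow> fseq" and h :: "fseq \<Rightarrow> ereal"
    and m M lam :: real
  assumes A1: "assmA1 n h" and A2: "assmA2 n g Dg h m M"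
    and lam_pos: "0 < lam" and lam_le: "lam \<le> 1 / (2 * m)"
begin

abbreviation D :: "fseq set" where "D \<equiv> edom n h"

definition L :: real where "L = lam * M + 1 / 2"

abbreviation gs :: "fseq \<Rightarrow> fseq \<Rightarrow> real" where
  "gs c \<equiv> \<lambda>x. lam * g x + 1 / 4 * (norm (x - c))\<^sup>2"

abbreviation Dgs :: "fseq \<Rightarrow> fseq \<Rightarrow> fseq" where
  "Dgs c \<equiv> \<lambda>x. lam *\<^sub>R Dg x + (1 / 2) *\<^sub>R (x - c)"

abbreviation hn :: "fseq \<Rightarrow> fseq \<Rightarrow> ereal" where
  "hn c \<equiv> \<lambda>x. ereal lam * h x + ereal (1 / 4 * (norm (x - c))\<^sup>2)"

abbreviation hs :: "fseq \<Rightarrow> fseq \<Rightarrow> real" where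
  "hs c \<equiv> \<lambda>x. lam * rpart h x + 1 / 4 * (norm (x - c))\<^sup>2"

abbreviation state :: "fseq \<Rightarrow> nat \<Rightarrow> real \<times> fseq \<times> fseq \<times> (fseq \<Rightarrow> real)" where
  "state c \<equiv> acg_state n (gs c) (Dgs c) (hn c) (1 / 2) L c"

definition A :: "fseq \<Rightarrow> nat \<Rightarrow> real" where "A c j = fst (state c j)"
definition X :: "fseq \<Rightarrow> nat \<Rightarrow> fseq" where "X c j = fst (snd (state c j))"
definition Y :: "fseq \<Rightarrow> nat \<Rightarrow> fseq" where "Y c j = fst (snd (snd (state c j)))"
definition G :: "fseq \<Rightarrow> nat \<Rightarrow> fseq \<Rightarrow> real" where "G c j = snd (snd (snd (state c j)))"

lemma state_eq: "state c j = (A c j, X c j, Y c j, G c j)"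
  by (simp add: A_def X_def Y_def G_def)

definition xtilde :: "fseq \<Rightarrow> nat \<Rightarrow> fseq" where
  "xtilde c j = (A c j / A c (Suc j)) *\<^sub>R X c j + ((A c (Suc j) - A c j) / A c (Suc j)) *\<^sub>R Y c j"

lemma m_pos: "0 < m" and M_pos: "0 < M"
  using A2 by (auto simp: assmA2_def)

lemma lam_m: "lam * m \<le> 1 / 2"
  using lam_le m_pos by (simp add: field_simps)

lemma L_pos: "0 < L"
  unfolding L_def using lam_pos M_pos by (simp add: add_pos_pos)

lemma A_0: "A c 0 = 0"
  and X_0: "X c 0 = c"
  and Y_0: "Y c 0 = c"
  and G_0: "G c 0 = (\<lambda>_. 0)"
  by (simp_all add: A_def X_def Y_def G_def)

lemma A_Suc: "A c (Suc j) = A c j + (1 / 2 * A c j + 1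
    + sqrt ((1 / 2 * A c j + 1)\<^sup>2 + 4 * L * (1 / 2 * A c j + 1) * A c j)) / (2 * L)"
  unfolding A_def by (simp add: Let_def split_beta)

lemma G_Suc: "G c (Suc j) = (\<lambda>w. A c j / A c (Suc j) * G c j w
    + (A c (Suc j) - A c j) / A c (Suc j) *
      (gs c (xtilde c j) + Dgs c (xtilde c j) \<bullet> (w - xtilde c j)))"
  unfolding xtilde_def A_Suc
  unfolding G_def A_def X_def Y_def by (simp add: Let_def split_beta lin_def)

lemma Y_Suc: "Y c (Suc j) = arg_min_on (\<lambda>w. ereal (G c (Suc j) w) + hn c w
    + ereal (1 / (2 * A c (Suc j)) * (norm (w - c))\<^sup>2)) (Rn n)"
  unfolding G_Suc xtilde_def A_Suc
  unfolding G_def A_def X_def Y_def by (simp add: Let_def split_beta lin_def)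

lemma X_Suc: "X c (Suc j) = (A c j / A c (Suc j)) *\<^sub>R X c j
    + ((A c (Suc j) - A c j) / A c (Suc j)) *\<^sub>R Y c (Suc j)"
  unfolding Y_Suc G_Suc xtilde_def A_Suc
  unfolding G_def A_def X_def Y_def by (simp add: Let_def split_beta lin_def)

sublocale weights: acg_weights "1 / 2" L "A c" for c
  by unfold_locales (use L_pos A_0 A_Suc in auto)

lemma G_affine: "affine_function (G c j)"
proof (induction j)
  case 0
  show ?case unfolding affine_function_def by (intro exI[of _ 0]) (simp add: G_0)
next
  case (Suc j)
  from affine_function_average[OF this] show ?case unfolding G_Suc .
qed

lemma D_subset: "D \<subseteq> Rn n"
  by (auto simp: edom_def)

lemma proper_h: "proper n h"
  using A1 by (simp add: assmA1_def)

text \<open>The choice made by \<^const>\<open>arg_min_on\<close> is meaningful only if a minimizer exists; it does, since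
  outside \<open>D\<close> the objective is infinite and on \<open>D\<close> \<open>minimizer_exists\<close> applies.\<close>

lemma subproblem_minimizer:
  assumes c: "c \<in> D"
  shows "Y c (Suc j) \<in> D"
    and "w \<in> D \<Longrightarrow>
      G c (Suc j) (Y c (Suc j)) + hs c (Y c (Suc j)) + 1 / (2 * A c (Suc j)) * (norm (Y c (Suc j) - c))\<^sup>2
      \<le> G c (Suc j) w + hs c w + 1 / (2 * A c (Suc j)) * (norm (w - c))\<^sup>2"
proof -
  define s where "s = 1 / (2 * A c (Suc j))"
  have s: "0 \<le> s" unfolding s_def using weights.A_nonneg[of c "Suc j"] by simp
  let ?G = "G c (Suc j)"
  let ?F = "\<lambda>w. ereal (?G w) + hn c w + ereal (s * (norm (w - c))\<^sup>2)"
  let ?f = "\<lambda>w. ?G w + hs c w + s * (norm (w - c))\<^sup>2"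
  define k where "k w = ?G w + (1 / 4 + s) * (norm (w - c))\<^sup>2" for w
  have f: "?f w = lam * rpart h w + k w" for w by (simp add: k_def algebra_simps)
  have F: "?F w = ereal (?f w)" if "w \<in> D" for w
    by (subst edom_value[OF proper_h that]) simp
  have F_inf: "?F w = \<infinity>" if "w \<in> Rn n" "w \<notin> D" for w
  proof -
    have "h w = \<infinity>" using that by (simp add: edom_def)
    then show ?thesis using lam_pos by simp
  qed
  obtain v b where vb: "\<And>w. ?G w = b + v \<bullet> w"
    using G_affine unfolding affine_function_def by blast
  have cont: "isCont k z" for z
    unfolding k_def vb by (intro continuous_intros)
  have growth: "1 / 4 * (norm (w - c))\<^sup>2 - norm v * norm (w - c) - (- ?G c) \<le> k w" for w
  proof -
    have "?G w = ?G c + v \<bullet> (w - c)" by (simp add: vb inner_diff_right)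
    moreover have "- (norm v * norm (w - c)) \<le> v \<bullet> (w - c)"
      using Cauchy_Schwarz_ineq2[of v "w - c"] by linarith
    moreover have "0 \<le> s * (norm (w - c))\<^sup>2" using s by simp
    ultimately show ?thesis unfolding k_def by (simp add: algebra_simps)
  qed
  have quarter: "0 < (1 / 4 :: real)" by simp
  obtain z where z: "z \<in> D" "\<And>w. w \<in> D \<Longrightarrow> lam * rpart h z + k z \<le> lam * rpart h w + k w"
    using minimizer_exists[OF A1 c lam_pos quarter cont growth] by blast
  have zR: "z \<in> Rn n" using z(1) D_subset by blast
  have zmin: "?F z \<le> ?F w" if "w \<in> Rn n" for w
  proof (cases "w \<in> D")
    case True
    have "?f z \<le> ?f w" unfolding f by (rule z(2)[OF True])
    then show ?thesis unfolding F[OF z(1)] F[OF True] by simp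
  next
    case False
    then show ?thesis unfolding F_inf[OF that False] by simp
  qed
  have Y: "Y c (Suc j) = arg_min_on ?F (Rn n)"
    unfolding Y_Suc s_def ..
  have YR: "Y c (Suc j) \<in> Rn n" and Ymin: "\<And>w. w \<in> Rn n \<Longrightarrow> ?F (Y c (Suc j)) \<le> ?F w"
    unfolding Y using arg_min_on_attained[where F="?F", OF zR zmin] by blast+
  show YD: "Y c (Suc j) \<in> D"
  proof (rule ccontr)
    assume "Y c (Suc j) \<notin> D"
    then have inf: "?F (Y c (Suc j)) = \<infinity>" by (rule F_inf[OF YR])
    have "?F (Y c (Suc j)) \<le> ereal (?f z)"
      using Ymin[OF zR] unfolding F[OF z(1)] .
    then show False unfolding inf by simp
  qed
  assume w: "w \<in> D"
  then have "w \<in> Rn n" using D_subset by blast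
  from Ymin[OF this] have "?f (Y c (Suc j)) \<le> ?f w"
    unfolding F[OF w] F[OF YD] by simp
  then show "G c (Suc j) (Y c (Suc j)) + hs c (Y c (Suc j)) + 1 / (2 * A c (Suc j)) * (norm (Y c (Suc j) - c))\<^sup>2
      \<le> G c (Suc j) w + hs c w + 1 / (2 * A c (Suc j)) * (norm (w - c))\<^sup>2"
    unfolding s_def .
qed

lemma convex_D: "convex D"
  unfolding convex_alt using convex_ereal_real(1)[OF proper_h] A1 by (auto simp: assmA1_def)

lemma acg_run:
  assumes c: "c \<in> D"
  shows "acg (1 / 2) L (A c) D (gs c) (Dgs c) (hs c) c (X c) (Y c) (G c)"
proof -
  have expand: "gs c w - (gs c z + Dgs c z \<bullet> (w - z))
      = lam * (g w - lin g Dg z w) + 1 / 4 * (norm (w - z))\<^sup>2" for z w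
    by (simp add: lin_def power2_norm_eq_inner inner_simps inner_commute algebra_simps)
  show ?thesis
  proof (unfold_locales, goal_cases)
    case 1 show ?case by (rule convex_D)
  next
    case 2 show ?case by (rule c)
  next
    case (3 z w)
    have "lam * (- (m / 2) * (norm (w - z))\<^sup>2) \<le> lam * (g w - lin g Dg z w)"
      using A2 3 lam_pos by (intro mult_left_mono) (auto simp: assmA2_def)
    moreover have "lam * m * (norm (w - z))\<^sup>2 \<le> 1 / 2 * (norm (w - z))\<^sup>2"
      using lam_m by (intro mult_right_mono) auto
    ultimately show ?case using expand[of w z] by (simp add: algebra_simps)
  next
    case (4 z w)
    have "lam * (g w - lin g Dg z w) \<le> lam * (M / 2 * (norm (w - z))\<^sup>2)"
      using A2 4 lam_pos by (intro mult_left_mono) (auto simp: assmA2_def)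
    moreover have "L / 2 * (norm (w - z))\<^sup>2 = lam * (M / 2 * (norm (w - z))\<^sup>2) + 1 / 4 * (norm (w - z))\<^sup>2"
      by (simp add: L_def algebra_simps)
    ultimately show ?case using expand[of w z] by linarith
  next
    case (5 z w t)
    have hle: "lam * rpart h ((1 - t) *\<^sub>R z + t *\<^sub>R w) \<le> lam * ((1 - t) * rpart h z + t * rpart h w)"
      using convex_ereal_real(2)[OF proper_h] A1 5 lam_pos
      by (intro mult_left_mono) (auto simp: assmA1_def)
    have N: "(norm ((1 - t) *\<^sub>R z + t *\<^sub>R w - c))\<^sup>2 = (1 - t) * (norm (z - c))\<^sup>2 + t * (norm (w - c))\<^sup>2
        - t * (1 - t) * (norm (w - z))\<^sup>2"
      using norm_convex_combination[of t "z - c" "w - c"] by (simp add: algebra_simps)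
    have E: "(1 - t) * hs c z + t * hs c w - 1 / 2 / 2 * (t * (1 - t)) * (norm (w - z))\<^sup>2
      = lam * ((1 - t) * rpart h z + t * rpart h w) + 1 / 4 * ((1 - t) * (norm (z - c))\<^sup>2
        + t * (norm (w - c))\<^sup>2 - t * (1 - t) * (norm (w - z))\<^sup>2)"
      by (simp add: field_simps)
    show ?case unfolding E N by (rule add_right_mono[OF hle])
  next
    case 6 show ?case by (rule X_0)
  next
    case 7 show ?case by (rule Y_0)
  next
    case (8 w) show ?case by (simp add: G_0)
  next
    case (9 j w) show ?case unfolding G_Suc xtilde_def ..
  next
    case (10 j) show ?case by (rule subproblem_minimizer(1)[OF c])
  next
    case (11 w j) then show ?case by (rule subproblem_minimizer(2)[OF c])
  next
    case (12 j) show ?case by (rule X_Suc)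
  qed
qed

definition U :: "fseq \<Rightarrow> nat \<Rightarrow> fseq" where
  "U c j = (1 / A c j) *\<^sub>R (c - Y c j)"

definition eta :: "fseq \<Rightarrow> nat \<Rightarrow> real" where
  "eta c j = gs c (X c j) + hs c (X c j) - G c j (Y c j) - hs c (Y c j) - U c j \<bullet> (X c j - Y c j)"

definition Phi :: "fseq \<Rightarrow> real" where
  "Phi w = g w + rpart h w"

definition prox_obj :: "fseq \<Rightarrow> fseq \<Rightarrow> real" where
  "prox_obj c w = lam * Phi w + 1 / 2 * (norm (w - c))\<^sup>2"

lemma X_in_D: "c \<in> D \<Longrightarrow> X c j \<in> D" and Y_in_D: "c \<in> D \<Longrightarrow> Y c j \<in> D"
  using acg.x_D[OF acg_run] acg.y_D[OF acg_run] by blast+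

lemma aipp_triple_eq:
  assumes "c \<in> D"
  shows "aipp_triple n g Dg h M lam c j = (X c j, U c j, eta c j)"
proof -
  have hn: "real_of_ereal (hn c w) = hs c w" if "w \<in> D" for w
    by (subst edom_value[OF proper_h that]) simp
  show ?thesis
    unfolding aipp_triple_def acg_triple_def L_def[symmetric] state_eq
    using hn[OF X_in_D[OF assms], of j] hn[OF Y_in_D[OF assms], of j]
    by (simp add: eta_def U_def)
qed

lemma U_in_Rn: "c \<in> D \<Longrightarrow> U c j \<in> Rn n"
  unfolding U_def using Y_in_D D_subset by (intro subspace_scale subspace_diff subspace_Rn) blast+

lemma run_u: "c \<in> D \<Longrightarrow> acg.u (A c) c (Y c) j = U c j"
  unfolding U_def by (rule acg.u_def[OF acg_run])

lemma run_f: "c \<in> D \<Longrightarrow> acg.f (gs c) (hs c) w = prox_obj c w"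
  by (subst acg.f_def[OF acg_run]) (simp_all add: prox_obj_def Phi_def distrib_left)

lemma run_eta:
  assumes "c \<in> D"
  shows "acg.\<eta> (A c) (gs c) (hs c) c (X c) (Y c) (G c) j = eta c j"
  unfolding acg.\<eta>_def[OF acg_run[OF assms]] acg.f_def[OF acg_run[OF assms]] run_u[OF assms] eta_def ..

lemma eta_nonneg:
  assumes "c \<in> D" and "1 \<le> j"
  shows "0 \<le> eta c j"
  using acg.eta_nonneg[OF acg_run[OF assms(1)] assms(2)] unfolding run_eta[OF assms(1)] .

lemma approximate_subgradient:
  assumes c: "c \<in> D" and "1 \<le> j" and "w \<in> D"
  shows "prox_obj c (X c j) + U c j \<bullet> (w - X c j) - eta c j \<le> prox_obj c w"
proof -
  have "0 \<le> (1 / 2) / 2 * (norm (w - Y c j))\<^sup>2" by simp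
  then show ?thesis
    using acg.subgradient_growth[OF acg_run[OF c] assms(2,3)]
    unfolding run_u[OF c] run_eta[OF c] run_f[OF c] by linarith
qed

section \<open>Iteration counts of the inner method\<close>

lemma sqrt_L_le: "sqrt L \<le> sqrt (lam * M + 1)" "sqrt (2 * L) \<le> 2 * sqrt (lam * M + 1)"
  and q_ge_1: "1 \<le> sqrt (lam * M + 1)"
proof -
  have p: "0 < lam * M" using lam_pos M_pos by simp
  then show "sqrt L \<le> sqrt (lam * M + 1)" "1 \<le> sqrt (lam * M + 1)" by (simp_all add: L_def)
  have "2 * (P + 1 / 2) \<le> 4 * (P + 1)" if "0 < P" for P :: real
    using that by simp
  from this[OF p] have "2 * L \<le> 4 * (lam * M + 1)" unfolding L_def .
  then have "sqrt (2 * L) \<le> sqrt (4 * (lam * M + 1))" by (rule real_sqrt_le_mono)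
  also have "\<dots> = 2 * sqrt (lam * M + 1)" by (simp only: real_sqrt_mult real_sqrt_four)
  finally show "sqrt (2 * L) \<le> 2 * sqrt (lam * M + 1)" .
qed

lemma two_L: "2 * lam * M + 1 = 2 * L"
  by (simp add: L_def)

lemma nat_ceiling_le: "0 \<le> x \<Longrightarrow> real (nat \<lceil>x\<rceil>) \<le> x + 1" for x :: real
  by linarith

definition min_iters :: nat where
  "min_iters = nat \<lceil>6 * sqrt (2 * lam * M + 1)\<rceil>"

text \<open>The prescribed minimal number of iterations serves to make the weight at least \<open>18\<close>, by
  \<open>A_growth_quadratic\<close>: \<open>(6 * sqrt (2 * L))^2 / (4 * L) = 18\<close>.\<close>

lemma after_min_iters:
  assumes "min_iters \<le> j"
  shows "1 \<le> j" and "18 \<le> A c j"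
proof -
  have p: "0 < lam * M" using lam_pos M_pos by simp
  have "6 * sqrt (2 * lam * M + 1) \<le> real min_iters"
    unfolding min_iters_def by (rule real_nat_ceiling_ge)
  then have j: "6 * sqrt (2 * L) \<le> real j" using assms unfolding two_L by simp
  have L: "1 \<le> 2 * L" using p by (simp add: L_def)
  then have "1 \<le> sqrt (2 * L)" by simp
  with j have "0 < real j" by linarith
  then show "1 \<le> j" by simp
  have "(6 * sqrt (2 * L))\<^sup>2 \<le> (real j)\<^sup>2" using j L by (intro power_mono) auto
  then have "18 * (4 * L) \<le> (real j)\<^sup>2" using L by (simp add: power_mult_distrib)
  then have "18 \<le> (real j)\<^sup>2 / (4 * L)" using L_pos by (simp add: field_simps)
  then show "18 \<le> A c j" using weights.A_growth_quadratic[of j c] by linarith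
qed

end

locale aipp_run = prox_problem +
  fixes \<sigma> \<rho> \<epsilon> :: real
  assumes sigma: "0 < \<sigma>" "\<sigma> < 1" and rho_pos: "0 < \<rho>" and eps_pos: "0 < \<epsilon>"
begin

abbreviation T :: "fseq \<Rightarrow> nat \<Rightarrow> fseq \<times> fseq \<times> real" where
  "T c \<equiv> aipp_triple n g Dg h M lam c"

abbreviation q :: real where "q \<equiv> sqrt (lam * M + 1)"

text \<open>From this index on, every iterate is acceptable: the second term makes the weight at least \<open>8 / \<sigma>\<close>.\<close>

definition step1_bound :: nat where
  "step1_bound = max min_iters (nat \<lceil>2 * sqrt (8 / \<sigma>) * sqrt L\<rceil>)"

lemma step1_bound_le: "real step1_bound \<le> (13 + 2 * sqrt (8 / \<sigma>)) * q"
proof -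
  have p: "0 < lam * M" using lam_pos M_pos by simp
  have "real min_iters \<le> 6 * sqrt (2 * L) + 1"
    unfolding min_iters_def two_L using L_pos by (intro nat_ceiling_le) simp
  then have "real min_iters \<le> 12 * q + 1" using sqrt_L_le(2) by linarith
  moreover have "real (nat \<lceil>2 * sqrt (8 / \<sigma>) * sqrt L\<rceil>) \<le> 2 * sqrt (8 / \<sigma>) * sqrt L + 1"
    using sigma L_pos by (intro nat_ceiling_le) simp
  moreover have "2 * sqrt (8 / \<sigma>) * sqrt L \<le> 2 * sqrt (8 / \<sigma>) * q"
    using sigma sqrt_L_le(1) by (intro mult_left_mono) auto
  moreover have "0 \<le> 2 * sqrt (8 / \<sigma>) * q" using sigma p by simp
  ultimately have "real min_iters \<le> (13 + 2 * sqrt (8 / \<sigma>)) * q"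
    "real (nat \<lceil>2 * sqrt (8 / \<sigma>) * sqrt L\<rceil>) \<le> (13 + 2 * sqrt (8 / \<sigma>)) * q"
    unfolding distrib_right using q_ge_1 by linarith+
  then show ?thesis
    unfolding step1_bound_def by (simp add: max_def)
qed

lemma large_weight:
  assumes "step1_bound \<le> j"
  shows "8 / \<sigma> \<le> A c j"
proof -
  have s: "0 \<le> 8 / \<sigma>" using sigma by simp
  have "2 * sqrt (8 / \<sigma>) * sqrt L \<le> real (nat \<lceil>2 * sqrt (8 / \<sigma>) * sqrt L\<rceil>)"
    by (rule real_nat_ceiling_ge)
  also have "\<dots> \<le> real j" using assms by (simp add: step1_bound_def)
  finally have "(2 * sqrt (8 / \<sigma>) * sqrt L)\<^sup>2 \<le> (real j)\<^sup>2"
    using s L_pos by (intro power_mono) auto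
  moreover have "(2 * sqrt (8 / \<sigma>) * sqrt L)\<^sup>2 = 4 * (8 / \<sigma>) * L"
    using s L_pos by (simp only: power_mult_distrib real_sqrt_pow2 less_imp_le) simp
  ultimately have "8 / \<sigma> * (4 * L) \<le> (real j)\<^sup>2" by (simp add: ac_simps)
  then have "8 / \<sigma> \<le> (real j)\<^sup>2 / (4 * L)" using L_pos by (subst pos_le_divide_eq) simp_all
  then show ?thesis using weights.A_growth_quadratic[of j c] by linarith
qed

lemma accepted_eventually:
  assumes "c \<in> D" and "step1_bound \<le> j"
  shows "accepted \<sigma> c (T c j)"
proof -
  have "1 \<le> j" using assms(2) by (intro after_min_iters(1)) (simp add: step1_bound_def)
  from acg.residual_dominates[OF acg_run[OF assms(1)] this sigma large_weight[OF assms(2)]]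
  show ?thesis
    unfolding accepted_def aipp_triple_eq[OF assms(1)] run_u[OF assms(1)] run_eta[OF assms(1)]
    by simp
qed

text \<open>Once \<open>A c i\<close> exceeds this threshold, the error \<open>eta c i / lam\<close> of a run that has passed Step 2
  is at most \<open>\<epsilon>\<close>, because the displacement is then bounded by \<open>lam * \<rho>\<close>.\<close>

definition target :: real where
  "target = lam * \<rho>\<^sup>2 / \<epsilon>"

lemma target_pos: "0 < target"
  unfolding target_def using lam_pos rho_pos eps_pos by simp

definition step3_extra :: nat where
  "step3_extra = nat \<lceil>2 * sqrt (2 * L) * max 0 (ln target)\<rceil>"

text \<open>The argument \<open>t\<close> of the logarithm satisfies \<open>t^2 = (lam * M + 1) * target \<ge> target\<close>, so
  \<open>ln target \<le> 2 * ln t\<close>; the rounding in \<open>step3_extra\<close> is absorbed because \<^const>\<open>log1_plus\<close> is at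
  least \<open>1\<close>.\<close>

lemma step3_extra_le:
  "real step3_extra \<le> 9 * q * log1_plus (\<rho> * sqrt ((lam * M + 1) * lam) / sqrt \<epsilon>)"
proof -
  define t where "t = \<rho> * sqrt ((lam * M + 1) * lam) / sqrt \<epsilon>"
  define l where "l = max 0 (ln target)"
  have p: "0 < lam * M" using lam_pos M_pos by simp
  have t: "0 < t" unfolding t_def using rho_pos eps_pos lam_pos p by simp
  have "t\<^sup>2 = (lam * M + 1) * target"
    unfolding t_def target_def using rho_pos eps_pos lam_pos p
    by (simp add: power_divide power_mult_distrib)
  moreover have "1 * target \<le> (lam * M + 1) * target"
    using target_pos p by (intro mult_right_mono) auto
  ultimately have "target \<le> t\<^sup>2" by simp
  then have "ln target \<le> ln (t\<^sup>2)" using target_pos t by (subst ln_le_cancel_iff) auto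
  also have "\<dots> = 2 * ln t" using t by (simp add: ln_realpow)
  also have "\<dots> \<le> 2 * log1_plus t" by (simp add: log1_plus_def)
  finally have l: "l \<le> 2 * log1_plus t" by (simp add: l_def log1_plus_def)
  have l0: "0 \<le> l" by (simp add: l_def)
  have g1: "1 \<le> log1_plus t" by (simp add: log1_plus_def)
  have "2 * sqrt (2 * L) * l \<le> 2 * (2 * q) * (2 * log1_plus t)"
    using sqrt_L_le(2) l l0 q_ge_1 L_pos by (intro mult_mono) auto
  moreover have "real step3_extra \<le> 2 * sqrt (2 * L) * l + 1"
    unfolding step3_extra_def l_def[symmetric]
    using l0 L_pos by (intro nat_ceiling_le) simp
  moreover have "1 * 1 \<le> q * log1_plus t" using q_ge_1 g1 by (intro mult_mono) auto
  ultimately show ?thesis unfolding t_def[symmetric] by (simp add: algebra_simps)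
qed

text \<open>With \<open>d = 1 / sqrt (2 * L) \<le> 1\<close> the growth factor satisfies \<open>1 + d \<ge> exp (d / 2)\<close>.\<close>

lemma weight_reaches_target:
  assumes "1 \<le> A c j"
  shows "target \<le> A c (j + step3_extra)"
proof -
  define d where "d = sqrt ((1 / 2) / L)"
  define l where "l = max 0 (ln target)"
  have p: "0 < lam * M" using lam_pos M_pos by simp
  have d0: "0 \<le> d" unfolding d_def using L_pos by simp
  have d1: "d \<le> 1" unfolding d_def using p by (simp add: L_def)
  have d2: "d * sqrt (2 * L) = 1"
    unfolding d_def real_sqrt_mult[symmetric] using L_pos by simp
  have "exp (d / 2) \<le> 1 + d / 2 + (d / 2)\<^sup>2" using d0 d1 by (intro exp_bound) auto
  also have "\<dots> \<le> 1 + d"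
    using mult_mono[of d 1 d d] d0 d1 by (simp add: power2_eq_square)
  finally have e: "exp (d / 2) \<le> 1 + d" .
  have "2 * sqrt (2 * L) * l \<le> real step3_extra"
    unfolding step3_extra_def l_def[symmetric] by (rule real_nat_ceiling_ge)
  then have "d * (2 * sqrt (2 * L) * l) \<le> d * real step3_extra"
    using d0 by (intro mult_left_mono) auto
  moreover have "d * (2 * sqrt (2 * L) * l) = 2 * ((d * sqrt (2 * L)) * l)" by (simp only: ac_simps)
  then have "d * (2 * sqrt (2 * L) * l) = 2 * l" by (simp only: d2 mult_1)
  ultimately have "2 * l \<le> d * real step3_extra" by linarith
  then have "l \<le> real step3_extra * (d / 2)" by (simp add: mult.commute)
  then have "ln target \<le> real step3_extra * (d / 2)" unfolding l_def by linarith
  then have "exp (ln target) \<le> exp (real step3_extra * (d / 2))" by simp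
  then have "target \<le> exp (real step3_extra * (d / 2))"
    using target_pos by simp
  then have "target \<le> exp (d / 2) ^ step3_extra"
    unfolding exp_of_nat_mult .
  also have "\<dots> \<le> (1 + d) ^ step3_extra" using e by (intro power_mono) auto
  also have "\<dots> \<le> A c j * (1 + d) ^ step3_extra"
    using mult_right_mono[OF assms, of "(1 + d) ^ step3_extra"] d0 by simp
  also have "\<dots> \<le> A c (j + step3_extra)"
    unfolding d_def by (rule weights.A_growth_geometric)
  finally show ?thesis .
qed

end

section \<open>Termination and output of the inner method\<close>

definition step1_const :: "real \<Rightarrow> real" where
  "step1_const \<sigma> = 13 + 2 * sqrt (8 / \<sigma>)"

definition complexity_const :: "real \<Rightarrow> real" where
  "complexity_const \<sigma> = 50 / (1 - \<sigma>)\<^sup>2 * step1_const \<sigma> + 3 * step1_const \<sigma> + 9"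

lemma step1_const_pos: "0 < \<sigma> \<Longrightarrow> 0 < step1_const \<sigma>"
  unfolding step1_const_def by (intro add_pos_nonneg) simp_all

lemma complexity_const_pos:
  assumes "0 < \<sigma>"
  shows "0 < complexity_const \<sigma>"
proof -
  have "0 \<le> 50 / (1 - \<sigma>)\<^sup>2 * step1_const \<sigma>" "0 < 3 * step1_const \<sigma>"
    using step1_const_pos[OF assms] by simp_all
  then show ?thesis unfolding complexity_const_def by linarith
qed

context aipp_run
begin

lemma accepted_X:
  assumes "c \<in> D"
  shows "accepted \<sigma> c (T c j) \<longleftrightarrow> (norm (U c j))\<^sup>2 + 2 * eta c j \<le> \<sigma> * (norm (c - X c j + U c j))\<^sup>2"
  by (simp add: accepted_def aipp_triple_eq[OF assms])

lemma step1_terminates: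
  assumes "c \<in> D"
  obtains j where "j \<le> step1_bound" and "first_from min_iters (\<lambda>i. accepted \<sigma> c (T c i)) j"
proof -
  have "min_iters \<le> step1_bound" by (simp add: step1_bound_def)
  from first_from_exists[where P="\<lambda>i. accepted \<sigma> c (T c i)", OF accepted_eventually[OF assms order_refl] this]
  show thesis using that by blast
qed

text \<open>A weight of at least \<open>18\<close> gives \<open>|u| \<le> r / 9\<close> for a displacement of norm \<open>r\<close>. Hence \<open>r \<le> 9/8 * (lam * \<rho> / 5)\<close> when Step 2
  succeeds, and later displacements are at most \<open>4 * 9/8 * lam * \<rho> / 5 = 9/10 * lam * \<rho>\<close>. Adding \<open>|u|\<close>
  multiplies this by at most \<open>10/9\<close>, so the final residual is at most \<open>lam * \<rho>\<close>: this is where the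
  factor \<open>5\<close> in the test of Step 2 is used up.\<close>

lemma displacement_after_step2:
  assumes c: "c \<in> D" and j: "min_iters \<le> j" and i: "j \<le> i"
    and small: "norm (c - X c j + U c j) \<le> lam * \<rho> / 5"
  shows "norm (X c i - c) \<le> 9 / 10 * (lam * \<rho>)"
    and "norm (U c i) \<le> norm (X c i - c) / 9"
proof -
  have j1: "1 \<le> j" and Aj: "18 \<le> A c j" using after_min_iters[OF j] .
  have u: "norm (U c k) \<le> norm (X c k - c) / 9" if "min_iters \<le> k" for k
  proof -
    have "2 / A c k * norm (X c k - c) \<le> 2 / 18 * norm (X c k - c)"
      using after_min_iters(2)[OF that, of c] by (intro mult_right_mono divide_left_mono) auto
    then show ?thesis
      using acg.u_bound[OF acg_run[OF c] after_min_iters(1)[OF that]] unfolding run_u[OF c] by simp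
  qed
  show "norm (U c i) \<le> norm (X c i - c) / 9" using u i j by simp
  have "norm (X c j - c) \<le> norm (c - X c j + U c j) + norm (U c j)"
    using norm_triangle_ineq4[of "c - X c j + U c j" "U c j"] by (simp add: norm_minus_commute)
  then have "norm (X c j - c) \<le> 9 / 8 * (lam * \<rho> / 5)"
    using u[OF j] small by linarith
  moreover have "norm (X c i - c) \<le> 4 * norm (X c j - c)"
    by (rule acg.displacement_stable[OF acg_run[OF c] j1 i Aj refl])
  ultimately show "norm (X c i - c) \<le> 9 / 10 * (lam * \<rho>)" by linarith
qed

lemma eta_at_target:
  assumes c: "c \<in> D" and "1 \<le> i" and "norm (X c i - c) \<le> 9 / 10 * (lam * \<rho>)"
    and "target \<le> A c i"
  shows "eta c i / lam \<le> \<epsilon>"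
proof -
  have "eta c i \<le> (norm (X c i - c))\<^sup>2 / (2 * A c i)"
    using acg.eta_bound[OF acg_run[OF c] assms(2)] unfolding run_eta[OF c] .
  also have "\<dots> \<le> (lam * \<rho>)\<^sup>2 / (1 * target)"
  proof (rule frac_le)
    have "0 \<le> lam * \<rho>" using lam_pos rho_pos by simp
    then have "norm (X c i - c) \<le> lam * \<rho>" using assms(3) by linarith
    then show "(norm (X c i - c))\<^sup>2 \<le> (lam * \<rho>)\<^sup>2" by (intro power_mono) auto
  qed (use assms(4) target_pos in auto)
  also have "\<dots> = lam * \<epsilon>"
    unfolding target_def using lam_pos rho_pos eps_pos by (simp add: power2_eq_square)
  finally show ?thesis using lam_pos by (simp add: pos_divide_le_eq mult.commute)
qed

lemma step3_terminates:
  assumes c: "c \<in> D" and j: "first_from min_iters (\<lambda>i. accepted \<sigma> c (T c i)) j" "j \<le> step1_bound"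
    and small: "norm (c - X c j + U c j) \<le> lam * \<rho> / 5"
  obtains j' where "j' \<le> step1_bound + step3_extra"
    and "first_from j (\<lambda>i. accepted \<sigma> c (T c i) \<and> snd (snd (T c i)) / lam \<le> \<epsilon>) j'"
proof -
  let ?b = "step1_bound + step3_extra"
  have mj: "min_iters \<le> j" using j(1) by (simp add: first_from_def)
  have mb: "min_iters \<le> step1_bound" by (simp add: step1_bound_def)
  have jb: "j \<le> ?b" using j(2) by simp
  have "1 \<le> A c step1_bound" using after_min_iters(2)[OF mb, of c] by linarith
  then have "target \<le> A c ?b" by (rule weight_reaches_target)
  moreover have "1 \<le> ?b" using after_min_iters(1)[OF mj] jb by linarith
  ultimately have "eta c ?b / lam \<le> \<epsilon>"
    using eta_at_target[OF c] displacement_after_step2(1)[OF c mj jb small] by blast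
  moreover have "accepted \<sigma> c (T c ?b)" by (rule accepted_eventually[OF c]) simp
  ultimately have "accepted \<sigma> c (T c ?b) \<and> snd (snd (T c ?b)) / lam \<le> \<epsilon>"
    by (simp add: aipp_triple_eq[OF c])
  from first_from_exists[where P="\<lambda>i. accepted \<sigma> c (T c i) \<and> snd (snd (T c i)) / lam \<le> \<epsilon>", OF this jb]
  show thesis using that by blast
qed

lemma Phi_ereal: "w \<in> D \<Longrightarrow> phi g h w = ereal (Phi w)"
  unfolding phi_def Phi_def by (subst edom_value[OF proper_h]) simp_all

lemma edom_phi: "edom n (phi g h) = D"
  unfolding edom_def phi_def by (auto simp: less_top[symmetric])

lemma output_is_solution:
  assumes c: "c \<in> D" and j: "min_iters \<le> j" "j \<le> j'"
    and small: "norm (c - X c j + U c j) \<le> lam * \<rho> / 5"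
    and tol: "eta c j' / lam \<le> \<epsilon>"
  shows "prox_approx_solution n g h \<rho> \<epsilon> (lam, c, X c j', (1 / lam) *\<^sub>R U c j', eta c j' / lam)"
proof -
  let ?x = "X c j'" and ?u = "U c j'" and ?e = "eta c j'"
  have j1: "1 \<le> j'" using after_min_iters(1)[OF j(1)] j(2) by simp
  have x: "?x \<in> D" by (rule X_in_D[OF c])
  have w: "(1 / lam) *\<^sub>R ?u \<in> Rn n" by (intro subspace_scale subspace_Rn U_in_Rn c)
  have sub: "phi g h ?x + ereal (1 / (2 * lam) * (norm (?x - c))\<^sup>2)
      + ereal (((1 / lam) *\<^sub>R ?u) \<bullet> (v - ?x) - ?e / lam)
    \<le> phi g h v + ereal (1 / (2 * lam) * (norm (v - c))\<^sup>2)" if v: "v \<in> Rn n" for v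
  proof (cases "v \<in> D")
    case True
    have scale: "Phi w + 1 / (2 * lam) * (norm (w - c))\<^sup>2 = 1 / lam * prox_obj c w" for w
      using lam_pos by (simp add: prox_obj_def field_simps)
    have "1 / lam * (prox_obj c ?x + ?u \<bullet> (v - ?x) - ?e) \<le> 1 / lam * prox_obj c v"
      using approximate_subgradient[OF c j1 True] lam_pos by (intro mult_left_mono) auto
    moreover have "1 / lam * (prox_obj c ?x + ?u \<bullet> (v - ?x) - ?e)
        = 1 / lam * prox_obj c ?x + (((1 / lam) *\<^sub>R ?u) \<bullet> (v - ?x) - ?e / lam)"
      by (simp add: add_divide_distrib diff_divide_distrib)
    ultimately have "Phi ?x + 1 / (2 * lam) * (norm (?x - c))\<^sup>2
        + (((1 / lam) *\<^sub>R ?u) \<bullet> (v - ?x) - ?e / lam)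
      \<le> Phi v + 1 / (2 * lam) * (norm (v - c))\<^sup>2"
      unfolding scale by linarith
    then show ?thesis unfolding Phi_ereal[OF x] Phi_ereal[OF True] by simp
  next
    case False
    then have "h v = \<infinity>" using v by (simp add: edom_def)
    then show ?thesis by (simp add: phi_def)
  qed
  have "norm (c - ?x + ?u) \<le> norm (?x - c) + norm ?u"
    using norm_triangle_ineq[of "c - ?x" ?u] by (simp add: norm_minus_commute)
  also have "\<dots> \<le> lam * \<rho>"
    using displacement_after_step2[OF c j small] by linarith
  finally have "norm (c - ?x + ?u) / lam \<le> \<rho>" using lam_pos by (simp add: pos_divide_le_eq mult.commute)
  moreover have "(1 / lam) *\<^sub>R (c - ?x) + (1 / lam) *\<^sub>R ?u = (1 / lam) *\<^sub>R (c - ?x + ?u)"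
    by (simp only: scaleR_add_right)
  ultimately have res: "norm ((1 / lam) *\<^sub>R (c - ?x) + (1 / lam) *\<^sub>R ?u) \<le> \<rho>"
    using lam_pos by simp
  have "0 \<le> ?e / lam" using eta_nonneg[OF c j1] lam_pos by simp
  moreover have "c \<in> Rn n" using c D_subset by blast
  moreover have "(1 / lam) *\<^sub>R ?u \<in> eps_subdiff n (?e / lam)
      (\<lambda>u. phi g h u + ereal (1 / (2 * lam) * (norm (u - c))\<^sup>2)) ?x"
    unfolding eps_subdiff_def using w sub by blast
  ultimately show ?thesis
    unfolding prox_approx_solution_def split edom_phi using lam_pos x res tol by blast
qed

section \<open>The outer iteration\<close>

text \<open>The approximate subgradient inequality with the square completed around the residual \<open>r\<close>; the acceptance
  test \<open>|v|^2 + 2 \<eta> \<le> \<sigma> |r|^2\<close> pays for the error terms. Taking \<open>w = c\<close> gives the descent of the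
  outer iteration, a general \<open>w\<close> gives the bound on the first step.\<close>

lemma prox_step:
  assumes c: "c \<in> D" and "1 \<le> j" and "w \<in> D" and acc: "accepted \<sigma> c (T c j)"
  defines "v \<equiv> U c j" and "r \<equiv> c - X c j + U c j"
  shows "lam * Phi (X c j) + (1 - \<sigma>) / 2 * (norm r)\<^sup>2 + v \<bullet> (w - c)
    \<le> lam * Phi w + 1 / 2 * (norm (w - c))\<^sup>2"
proof -
  have "v \<bullet> (w - X c j) + 1 / 2 * (norm (X c j - c))\<^sup>2 = v \<bullet> (w - c) + 1 / 2 * (norm r)\<^sup>2 - 1 / 2 * (norm v)\<^sup>2"
    unfolding r_def v_def
    by (simp add: power2_norm_eq_inner inner_simps inner_commute algebra_simps)
  moreover have "lam * Phi (X c j) + 1 / 2 * (norm (X c j - c))\<^sup>2 + v \<bullet> (w - X c j) - eta c j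
      \<le> lam * Phi w + 1 / 2 * (norm (w - c))\<^sup>2"
    using approximate_subgradient[OF assms(1-3)] unfolding prox_obj_def v_def by simp
  moreover have "(norm v)\<^sup>2 + 2 * eta c j \<le> \<sigma> * (norm r)\<^sup>2"
    using acc unfolding accepted_X[OF c] v_def r_def .
  moreover have "(1 - \<sigma>) / 2 * (norm r)\<^sup>2 = 1 / 2 * (norm r)\<^sup>2 - \<sigma> * (norm r)\<^sup>2 / 2"
    by (simp add: field_simps)
  ultimately show ?thesis by linarith
qed

lemma sufficient_descent:
  assumes "c \<in> D" and "1 \<le> j" and "accepted \<sigma> c (T c j)"
  shows "lam * Phi (X c j) + (1 - \<sigma>) / 2 * (norm (c - X c j + U c j))\<^sup>2 \<le> lam * Phi c"
  using prox_step[OF assms(1,2,1,3)] by simp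

text \<open>The inner product \<open>v \<bullet> p\<close>, with \<open>p = w - c\<close>, is absorbed by Young's inequality in the form
  \<open>|(1 - \<sigma>) v + \<sigma> p|^2 \<ge> 0\<close>, together with \<open>|v|^2 \<le> \<sigma> |r|^2\<close>.\<close>

lemma first_step_bound:
  assumes c: "c \<in> D" and "1 \<le> j" and w: "w \<in> D" and acc: "accepted \<sigma> c (T c j)"
  shows "(1 - \<sigma>) * lam * Phi (X c j) \<le> 1 / 2 * (norm (c - w))\<^sup>2 + (1 - \<sigma>) * lam * Phi w"
proof -
  define v where "v = U c j"
  define r where "r = c - X c j + U c j"
  define p where "p = w - c"
  have "(norm v)\<^sup>2 \<le> \<sigma> * (norm r)\<^sup>2"
    using acc eta_nonneg[OF c assms(2)] unfolding accepted_X[OF c] v_def r_def by linarith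
  then have "(1 - \<sigma>)\<^sup>2 * (norm v)\<^sup>2 \<le> (1 - \<sigma>)\<^sup>2 * (\<sigma> * (norm r)\<^sup>2)"
    by (intro mult_left_mono) auto
  moreover have "0 \<le> (norm ((1 - \<sigma>) *\<^sub>R v + \<sigma> *\<^sub>R p))\<^sup>2" by simp
  moreover have square: "(norm (s *\<^sub>R v + t *\<^sub>R p))\<^sup>2
      = s\<^sup>2 * (norm v)\<^sup>2 + 2 * s * t * (v \<bullet> p) + t\<^sup>2 * (norm p)\<^sup>2" for s t :: real
    unfolding power2_norm_eq_inner
    by (simp add: inner_simps inner_commute power2_eq_square algebra_simps)
  ultimately have "0 \<le> (1 - \<sigma>)\<^sup>2 * (\<sigma> * (norm r)\<^sup>2) + 2 * (1 - \<sigma>) * \<sigma> * (v \<bullet> p) + \<sigma>\<^sup>2 * (norm p)\<^sup>2"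
    using square[of "1 - \<sigma>" \<sigma>] by linarith
  also have "\<dots> = \<sigma> * ((1 - \<sigma>)\<^sup>2 * (norm r)\<^sup>2 + 2 * (1 - \<sigma>) * (v \<bullet> p) + \<sigma> * (norm p)\<^sup>2)"
    by (simp add: power2_eq_square algebra_simps)
  finally have "0 \<le> \<sigma> * ((1 - \<sigma>)\<^sup>2 * (norm r)\<^sup>2 + 2 * (1 - \<sigma>) * (v \<bullet> p) + \<sigma> * (norm p)\<^sup>2)" .
  then have young: "0 \<le> (1 - \<sigma>)\<^sup>2 * (norm r)\<^sup>2 + 2 * (1 - \<sigma>) * (v \<bullet> p) + \<sigma> * (norm p)\<^sup>2"
    using sigma by (simp add: zero_le_mult_iff)
  have "(1 - \<sigma>) * (lam * Phi (X c j) + (1 - \<sigma>) / 2 * (norm r)\<^sup>2 + v \<bullet> p)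
      \<le> (1 - \<sigma>) * (lam * Phi w + 1 / 2 * (norm p)\<^sup>2)"
    using prox_step[OF c assms(2) w acc] sigma unfolding v_def r_def p_def
    by (intro mult_left_mono) auto
  then have "(1 - \<sigma>) * lam * Phi (X c j) \<le> (1 - \<sigma>) * lam * Phi w + (1 - \<sigma>) * (1 / 2 * (norm p)\<^sup>2)
      - ((1 - \<sigma>)\<^sup>2 * (norm r)\<^sup>2 + 2 * (1 - \<sigma>) * (v \<bullet> p)) / 2"
    by (simp add: power2_eq_square field_simps)
  also have "\<dots> \<le> (1 - \<sigma>) * lam * Phi w + 1 / 2 * (norm p)\<^sup>2"
    using young by (simp add: field_simps)
  finally show ?thesis by (simp add: p_def norm_minus_commute)
qed

abbreviation run_from :: "fseq \<Rightarrow> nat \<Rightarrow> real \<times> fseq \<times> fseq \<times> fseq \<times> real \<Rightarrow> bool" where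
  "run_from \<equiv> aipp n g Dg h M \<sigma> lam \<rho> \<epsilon>"

lemma outer_iteration:
  assumes c: "c \<in> D"
  obtains (stop) N out where "run_from c N out" "prox_approx_solution n g h \<rho> \<epsilon> out"
      "fst out = lam" "N \<le> step1_bound + step3_extra"
  | (move) j where "first_from min_iters (\<lambda>i. accepted \<sigma> c (T c i)) j" "j \<le> step1_bound" "1 \<le> j" "accepted \<sigma> c (T c j)"
      "lam * \<rho> / 5 < norm (c - X c j + U c j)"
      "\<And>N out. run_from (X c j) N out \<Longrightarrow> run_from c (j + N) out"
proof -
  obtain j where j: "j \<le> step1_bound" "first_from min_iters (\<lambda>i. accepted \<sigma> c (T c i)) j"
    by (rule step1_terminates[OF c])
  note j2 = j(2)[unfolded min_iters_def]
  have mj: "min_iters \<le> j" and acc: "accepted \<sigma> c (T c j)"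
    using j(2) by (simp_all add: first_from_def)
  show thesis
  proof (cases "norm (c - X c j + U c j) \<le> lam * \<rho> / 5")
    case True
    obtain j' where j': "j' \<le> step1_bound + step3_extra"
        "first_from j (\<lambda>i. accepted \<sigma> c (T c i) \<and> snd (snd (T c i)) / lam \<le> \<epsilon>) j'"
      by (rule step3_terminates[OF c j(2,1) True])
    have "run_from c j' (lam, c, X c j', (1 / lam) *\<^sub>R U c j', eta c j' / lam)"
      by (rule aipp.finish[OF j2 aipp_triple_eq[OF c] True j'(2) aipp_triple_eq[OF c]])
    moreover have "prox_approx_solution n g h \<rho> \<epsilon> (lam, c, X c j', (1 / lam) *\<^sub>R U c j', eta c j' / lam)"
      using j'(2) by (intro output_is_solution[OF c mj _ True])
        (simp_all add: first_from_def aipp_triple_eq[OF c])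
    ultimately show thesis using stop j'(1) by simp
  next
    case False
    then have "run_from c (j + N) out" if "run_from (X c j) N out" for N out
      using aipp.continue[OF j2 aipp_triple_eq[OF c] _ that] by blast
    then show thesis
      using move[OF j(2,1) after_min_iters(1)[OF mj] acc] False by auto
  qed
qed

text \<open>A guaranteed decrease of \<open>lam * phi\<close> in an outer iteration that does not pass the test of Step 2.\<close>

definition decrease :: real where
  "decrease = (1 - \<sigma>) / 2 * (lam * \<rho> / 5)\<^sup>2"

lemma decrease_pos: "0 < decrease"
  unfolding decrease_def using sigma lam_pos rho_pos by simp

text \<open>The scaled gap \<open>lam * (phi - ps)\<close> stays nonnegative and pays \<open>decrease\<close> in each outer iteration, so a
  gap of at most \<open>k\<close> times \<open>decrease\<close> allows \<open>k\<close> of them besides the last one.\<close>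

lemma run_terminates:
  assumes low: "\<And>w. w \<in> D \<Longrightarrow> ps \<le> Phi w"
  shows "c \<in> D \<Longrightarrow> lam * (Phi c - ps) \<le> real k * decrease \<Longrightarrow>
    \<exists>N out. run_from c N out \<and> prox_approx_solution n g h \<rho> \<epsilon> out \<and> fst out = lam
      \<and> N \<le> (k + 1) * step1_bound + step3_extra"
proof (induction k arbitrary: c)
  case 0
  note c = \<open>c \<in> D\<close>
  show ?case
  proof (rule outer_iteration[OF c], goal_cases stop move)
    case (stop N out)
    then have "N \<le> (0 + 1) * step1_bound + step3_extra" by simp
    with stop(1-3) show ?thesis by blast
  next
    case (move j)
    have "0 < lam * \<rho> / 5" using lam_pos rho_pos by simp
    then have "0 < norm (c - X c j + U c j)" using move(5) by linarith
    then have "0 < (1 - \<sigma>) / 2 * (norm (c - X c j + U c j))\<^sup>2"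
      using sigma by (intro mult_pos_pos zero_less_power) simp_all
    then have "lam * Phi (X c j) < lam * Phi c"
      using sufficient_descent[OF \<open>c \<in> D\<close> move(3,4)] by linarith
    moreover have "lam * ps \<le> lam * Phi (X c j)"
      using low[OF X_in_D[OF \<open>c \<in> D\<close>]] lam_pos by (intro mult_left_mono) auto
    ultimately show ?thesis using 0 by (simp add: right_diff_distrib)
  qed
next
  case (Suc k)
  note c = \<open>c \<in> D\<close>
  show ?case
  proof (rule outer_iteration[OF c], goal_cases stop move)
    case (stop N out)
    have "1 * step1_bound \<le> (Suc k + 1) * step1_bound" by (rule mult_right_mono) simp_all
    then have "N \<le> (Suc k + 1) * step1_bound + step3_extra" using stop(4) by linarith
    with stop(1-3) show ?thesis by blast
  next
    case (move j)
    have "(lam * \<rho> / 5)\<^sup>2 \<le> (norm (c - X c j + U c j))\<^sup>2"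
      using move(5) lam_pos rho_pos by (intro power_mono) auto
    then have "decrease \<le> (1 - \<sigma>) / 2 * (norm (c - X c j + U c j))\<^sup>2"
      unfolding decrease_def using sigma by (intro mult_left_mono) auto
    then have "lam * Phi (X c j) + decrease \<le> lam * Phi c"
      using sufficient_descent[OF \<open>c \<in> D\<close> move(3,4)] by linarith
    then have "lam * (Phi (X c j) - ps) \<le> real k * decrease"
      using Suc.prems(2) by (simp add: algebra_simps)
    from Suc.IH[OF X_in_D[OF \<open>c \<in> D\<close>] this] obtain N out where
      N: "run_from (X c j) N out" "prox_approx_solution n g h \<rho> \<epsilon> out" "fst out = lam"
        "N \<le> (k + 1) * step1_bound + step3_extra"
      by blast
    then show ?thesis
      using move(6)[OF N(1)] move(2)
      by (intro exI[of _ "j + N"] exI[of _ out] conjI) simp_all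
  qed
qed

lemma phi_star_real:
  assumes "assmA3 n g h" and c: "c \<in> D"
  obtains ps where "phi_star n g h = ereal ps" and "\<And>w. w \<in> D \<Longrightarrow> ps \<le> Phi w"
proof -
  have le: "phi_star n g h \<le> ereal (Phi w)" if "w \<in> D" for w
    unfolding phi_star_def Phi_ereal[OF that, symmetric]
    using that D_subset by (intro INF_lower) blast
  have "- \<infinity> < phi_star n g h" using assms(1) by (simp add: assmA3_def)
  then obtain ps where ps: "phi_star n g h = ereal ps"
    using le[OF c] by (cases "phi_star n g h") auto
  show thesis using that[OF ps] le unfolding ps by simp
qed

text \<open>Points outside the domain contribute an infinite value to the infimum, the others are covered by
  \<open>first_step_bound\<close>.\<close>

lemma R_const_lower:
  assumes c: "c \<in> D" and ps: "phi_star n g h = ereal ps" and "1 \<le> j"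
    and acc: "accepted \<sigma> c (T c j)"
  shows "ereal ((1 - \<sigma>) * lam * (Phi (X c j) - ps)) \<le> R_const n g h \<sigma> c lam"
  unfolding R_const_def
proof (rule INF_greatest)
  fix w assume w: "w \<in> Rn n"
  define s where "s = (1 - \<sigma>) * lam"
  have s: "0 < s" unfolding s_def using sigma lam_pos by simp
  let ?R = "ereal (1 / 2 * (norm (c - w))\<^sup>2) + ereal s * (phi g h w - phi_star n g h)"
  have "ereal (s * (Phi (X c j) - ps)) \<le> ?R"
  proof (cases "w \<in> D")
    case True
    have "?R = ereal (1 / 2 * (norm (c - w))\<^sup>2 + s * (Phi w - ps))"
      unfolding Phi_ereal[OF True] ps by simp
    then show ?thesis
      using first_step_bound[OF c assms(3) True acc] unfolding s_def[symmetric]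
      by (simp add: right_diff_distrib)
  next
    case False
    then have "h w = \<infinity>" using w by (simp add: edom_def)
    then have inf: "phi g h w = \<infinity>" by (simp add: phi_def)
    have R_inf: "?R = \<infinity>" unfolding inf ps using s by simp
    show ?thesis unfolding R_inf by simp
  qed
  then show "ereal ((1 - \<sigma>) * lam * (Phi (X c j) - ps))
    \<le> ereal (1 / 2 * (norm (c - w))\<^sup>2) + ereal ((1 - \<sigma>) * lam) * (phi g h w - phi_star n g h)"
    unfolding s_def .
qed

section \<open>The complexity bound\<close>

text \<open>The first outer iteration is treated separately: after it the gap is controlled by \<^const>\<open>R_const\<close>, and
  \<open>run_terminates\<close> applies. Everything is computed with the real lower bound \<open>Q\<close> of \<^const>\<open>R_const\<close> and passed to
  extended reals at the end.\<close>

lemma aipp_complexity: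
  assumes A3: "assmA3 n g h" and c: "c \<in> D"
  shows "\<exists>N out. run_from c N out \<and> prox_approx_solution n g h \<rho> \<epsilon> out \<and> fst out = lam \<and>
    ereal (real N) \<le> ereal (complexity_const \<sigma> * q) *
      (R_const n g h \<sigma> c lam / ereal (lam\<^sup>2 * \<rho>\<^sup>2)
       + ereal (log1_plus (\<rho> * sqrt ((lam * M + 1) * lam) / sqrt \<epsilon>)))"
proof -
  define lg where "lg = log1_plus (\<rho> * sqrt ((lam * M + 1) * lam) / sqrt \<epsilon>)"
  define c1 where "c1 = step1_const \<sigma>"
  have lg: "1 \<le> lg" by (simp add: lg_def log1_plus_def)
  have c1: "0 \<le> c1" using step1_const_pos[OF sigma(1)] by (simp add: c1_def)
  obtain ps where ps: "phi_star n g h = ereal ps" and low: "\<And>w. w \<in> D \<Longrightarrow> ps \<le> Phi w"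
    using phi_star_real[OF A3 c] by blast
  obtain j where j: "first_from min_iters (\<lambda>i. accepted \<sigma> c (T c i)) j"
    by (rule step1_terminates[OF c])
  have j1: "1 \<le> j" and acc: "accepted \<sigma> c (T c j)"
    using j after_min_iters(1) by (simp_all add: first_from_def)
  define Q where "Q = (1 - \<sigma>) * lam * (Phi (X c j) - ps)"
  have Q0: "0 \<le> Q" unfolding Q_def using low[OF X_in_D[OF c]] sigma lam_pos by simp
  have QR: "ereal Q \<le> R_const n g h \<sigma> c lam"
    unfolding Q_def by (rule R_const_lower[OF c ps j1 acc])
  define Z where "Z = Q / (lam\<^sup>2 * \<rho>\<^sup>2)"
  have Z0: "0 \<le> Z" using Q0 by (simp add: Z_def)
  define k where "k = nat \<lceil>lam * (Phi (X c j) - ps) / decrease\<rceil>"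
  have gap0: "0 \<le> lam * (Phi (X c j) - ps) / decrease"
    using low[OF X_in_D[OF c]] lam_pos decrease_pos by simp
  have "lam * (Phi (X c j) - ps) / decrease \<le> real k"
    unfolding k_def by (rule real_nat_ceiling_ge)
  then have k: "lam * (Phi (X c j) - ps) \<le> real k * decrease"
    using decrease_pos by (simp add: pos_divide_le_eq)
  have "lam * P / (t / 2 * (lam * \<rho> / 5)\<^sup>2) = 50 / t\<^sup>2 * (t * lam * P / (lam\<^sup>2 * \<rho>\<^sup>2))"
    if "0 < t" for t P :: real
    using that lam_pos rho_pos by (simp add: field_simps power2_eq_square)
  from this[of "1 - \<sigma>" "Phi (X c j) - ps"]
  have "lam * (Phi (X c j) - ps) / decrease = 50 / (1 - \<sigma>)\<^sup>2 * Z"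
    unfolding Z_def Q_def decrease_def using sigma by simp
  then have k_le: "real k \<le> 50 / (1 - \<sigma>)\<^sup>2 * Z + 1"
    using nat_ceiling_le[OF gap0] unfolding k_def by simp
  have "\<exists>N out. run_from c N out \<and> prox_approx_solution n g h \<rho> \<epsilon> out \<and> fst out = lam
      \<and> N \<le> (k + 2) * step1_bound + step3_extra"
  proof (rule outer_iteration[OF c], goal_cases stop move)
    case (stop N out)
    have "1 * step1_bound \<le> (k + 2) * step1_bound" by (rule mult_right_mono) simp_all
    then have "N \<le> (k + 2) * step1_bound + step3_extra" using stop(4) by linarith
    with stop(1-3) show ?thesis by blast
  next
    case (move i)
    have "i = j" using first_from_unique[OF _ j] move(1) by blast
    obtain N out where N: "run_from (X c j) N out" "prox_approx_solution n g h \<rho> \<epsilon> out" "fst out = lam"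
        "N \<le> (k + 1) * step1_bound + step3_extra"
      using run_terminates[OF low X_in_D[OF c] k] by blast
    then show ?thesis
      using move(6)[unfolded \<open>i = j\<close>, OF N(1)] move(2)[unfolded \<open>i = j\<close>]
      by (intro exI[of _ "j + N"] exI[of _ out] conjI) simp_all
  qed
  then obtain N out where N: "run_from c N out" "prox_approx_solution n g h \<rho> \<epsilon> out" "fst out = lam"
      "N \<le> (k + 2) * step1_bound + step3_extra"
    by blast
  have "real N \<le> real ((k + 2) * step1_bound + step3_extra)"
    using N(4) by (simp only: of_nat_le_iff)
  also have "\<dots> = (real k + 2) * real step1_bound + real step3_extra"
    by (simp add: distrib_right)
  also have "\<dots> \<le> (50 / (1 - \<sigma>)\<^sup>2 * Z + 3) * (c1 * q) + 9 * q * lg"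
  proof (rule add_mono[OF mult_mono])
    show "real k + 2 \<le> 50 / (1 - \<sigma>)\<^sup>2 * Z + 3" using k_le by simp
    show "real step1_bound \<le> c1 * q" unfolding c1_def step1_const_def by (rule step1_bound_le)
    show "real step3_extra \<le> 9 * q * lg" unfolding lg_def by (rule step3_extra_le)
  qed (use Z0 in auto)
  also have "\<dots> = q * (50 / (1 - \<sigma>)\<^sup>2 * c1 * Z + (3 * c1 * 1 + 9 * lg))"
    by (simp add: algebra_simps)
  also have "\<dots> \<le> q * (complexity_const \<sigma> * Z + complexity_const \<sigma> * lg)"
  proof (intro mult_left_mono add_mono)
    have C: "complexity_const \<sigma> = 50 / (1 - \<sigma>)\<^sup>2 * c1 + 3 * c1 + 9"
      by (simp add: complexity_const_def c1_def)
    show "50 / (1 - \<sigma>)\<^sup>2 * c1 * Z \<le> complexity_const \<sigma> * Z"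
      unfolding C using c1 Z0 by (intro mult_right_mono) auto
    have "3 * c1 * 1 \<le> 3 * c1 * lg" using c1 lg by (intro mult_left_mono) auto
    moreover have "0 \<le> 50 / (1 - \<sigma>)\<^sup>2 * c1 * lg" using c1 lg by simp
    ultimately show "3 * c1 * 1 + 9 * lg \<le> complexity_const \<sigma> * lg"
      unfolding C by (simp add: distrib_right)
  qed (use q_ge_1 in simp)
  finally have real_bound: "real N \<le> complexity_const \<sigma> * q * (Z + lg)"
    by (simp add: algebra_simps)
  have "0 \<le> complexity_const \<sigma> * q"
    using complexity_const_pos[OF sigma(1)] q_ge_1 by simp
  moreover have "ereal Z \<le> R_const n g h \<sigma> c lam / ereal (lam\<^sup>2 * \<rho>\<^sup>2)"
  proof -
    have "0 < lam\<^sup>2 * \<rho>\<^sup>2" using lam_pos rho_pos by simp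
    then have "ereal Q / ereal (lam\<^sup>2 * \<rho>\<^sup>2) \<le> R_const n g h \<sigma> c lam / ereal (lam\<^sup>2 * \<rho>\<^sup>2)"
      using QR by (intro ereal_divide_right_mono) auto
    then show ?thesis using lam_pos rho_pos unfolding Z_def by simp
  qed
  ultimately have "ereal (complexity_const \<sigma> * q) * (ereal Z + ereal lg)
      \<le> ereal (complexity_const \<sigma> * q) * (R_const n g h \<sigma> c lam / ereal (lam\<^sup>2 * \<rho>\<^sup>2) + ereal lg)"
    by (intro ereal_mult_left_mono add_right_mono) auto
  moreover have "ereal (real N) \<le> ereal (complexity_const \<sigma> * q) * (ereal Z + ereal lg)"
    using real_bound by simp
  ultimately show ?thesis using N(1-3) unfolding lg_def by (blast intro: order_trans)
qed

end

theorem theorem3p6: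
  fixes \<sigma> :: real
  assumes "0 < \<sigma>" and "\<sigma> < 1"
  shows "\<exists>C>0. \<forall>(n::nat) (g::fseq \<Rightarrow> real) (Dg::fseq \<Rightarrow> fseq) (h::fseq \<Rightarrow> ereal)
           (m::real) (M::real) (z0::fseq) (lam::real) (\<rho>::real) (\<epsilon>::real).
         assmA1 n h \<longrightarrow> assmA2 n g Dg h m M \<longrightarrow> assmA3 n g h \<longrightarrow>
         z0 \<in> edom n h \<longrightarrow> 0 < lam \<longrightarrow> lam \<le> 1 / (2 * m) \<longrightarrow> 0 < \<rho> \<longrightarrow> 0 < \<epsilon> \<longrightarrow>
         (\<exists>N out. aipp n g Dg h M \<sigma> lam \<rho> \<epsilon> z0 N out \<and>
            prox_approx_solution n g h \<rho> \<epsilon> out \<and> fst out = lam \<and>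
            ereal (real N) \<le> ereal (C * sqrt (lam * M + 1)) *
              (R_const n g h \<sigma> z0 lam / ereal (lam\<^sup>2 * \<rho>\<^sup>2)
               + ereal (log1_plus (\<rho> * sqrt ((lam * M + 1) * lam) / sqrt \<epsilon>))))"
proof (rule exI[of _ "complexity_const \<sigma>"], intro conjI allI impI)
  show "0 < complexity_const \<sigma>" by (rule complexity_const_pos[OF assms(1)])
  fix n :: nat and g :: "fseq \<Rightarrow> real" and Dg :: "fseq \<Rightarrow> fseq" and h :: "fseq \<Rightarrow> ereal"
    and m M :: real and z0 :: fseq and lam \<rho> \<epsilon> :: real
  assume "assmA1 n h" "assmA2 n g Dg h m M" and A3: "assmA3 n g h" and z0: "z0 \<in> edom n h"
    and "0 < lam" "lam \<le> 1 / (2 * m)" "0 < \<rho>" "0 < \<epsilon>"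
  then interpret aipp_run n g Dg h m M lam \<sigma> \<rho> \<epsilon>
    using assms by unfold_locales
  show "\<exists>N out. aipp n g Dg h M \<sigma> lam \<rho> \<epsilon> z0 N out \<and>
      prox_approx_solution n g h \<rho> \<epsilon> out \<and> fst out = lam \<and>
      ereal (real N) \<le> ereal (complexity_const \<sigma> * sqrt (lam * M + 1)) *
        (R_const n g h \<sigma> z0 lam / ereal (lam\<^sup>2 * \<rho>\<^sup>2)
         + ereal (log1_plus (\<rho> * sqrt ((lam * M + 1) * lam) / sqrt \<epsilon>)))"
    by (rule aipp_complexity[OF A3 z0])
qed

end
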